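(* Consider a LogBgt-SetCov instance and assume a $1$-valid solution exists. Then there is a randomized algorithm that finds an $O(\log n)$-valid solution with probability larger than $1/2$.
   Context: Set cover: a finite set $A$ of elements and a collection $\mathcal{U}$ of subsets of $A$ (with $n=|\mathcal{U}|$); the feasible family is $\mathcal{F}=\{D\subseteq\mathcal{U}:\bigcup_{Q\in D}Q=A\}$. LogBgt-SetCov: given also pairwise disjoint $S_1,\dots,S_T\subseteq\mathcal{U}$ with $T=\lceil\log_2 n\rceil$. A set $D\subseteq\mathcal{U}$ is $c'$-valid if $D\in\mathcal{F}$ and $|D\cap S_i|\le c'2^i$ for all $1\le i\le T$. *)

theory Defs
  imports "HOL-Probability.Probability" "HOL-Library.Landau_Symbols"
    "HOL-Computational_Algebra.Polynomial"
begin

section \<open>Log-budgeted set cover\<close>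

definition levels :: "'a set set \<Rightarrow> nat" where
  "levels U = nat \<lceil>log 2 (real (card U))\<rceil>"

text \<open>Only the values of \<open>S\<close> at \<open>1, \<dots>, levels U\<close> belong to the instance.\<close>

definition logbgt_setcov :: "'a set \<Rightarrow> 'a set set \<Rightarrow> (nat \<Rightarrow> 'a set set) \<Rightarrow> bool" where
  "logbgt_setcov A U S \<longleftrightarrow>
     finite A \<and> U \<subseteq> Pow A \<and>
     (\<forall>i\<in>{1..levels U}. S i \<subseteq> U) \<and>
     disjoint_family_on S {1..levels U}"

definition feasible :: "'a set \<Rightarrow> 'a set set \<Rightarrow> 'a set set set" where
  "feasible A U = {D. D \<subseteq> U \<and> \<Union>D = A}"

definition valid ::
  "'a set \<Rightarrow> 'a set set \<Rightarrow> (nat \<Rightarrow> 'a set set) \<Rightarrow> real \<Rightarrow> 'a set set \<Rightarrow> bool" where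
  "valid A U S c D \<longleftrightarrow>
     D \<in> feasible A U \<and> (\<forall>i\<in>{1..levels U}. real (card (D \<inter> S i)) \<le> c * 2 ^ i)"


section \<open>Randomized algorithms\<close>

text \<open>
  Algorithms are while-programs on a random access machine over the natural numbers. A state
  consists of registers, which programs address by constants, and of a memory, which they address
  by computed values. Randomness comes from a fair coin. One step is charged
  per command. There is deliberately no multiplication: with addition and truncated subtraction
  as the only arithmetic, the bit length of every number grows by at most a constant (depending
  on the program) per step, so that running times on this machine and on probabilistic Turing
  machines are polynomially related.
\<close>

type_synonym state = "(nat \<Rightarrow> nat) \<times> (nat \<Rightarrow> nat)"

datatype aexp = Num nat | Reg nat | Mem aexp | Plus aexp aexp | Minus aexp aexp

datatype bexp = Less aexp aexp | Not bexp | And bexp bexp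

datatype com =
    Skip
  | Assign nat aexp
  | Store aexp aexp
  | Flip nat
  | Seq com com
  | Cond bexp com com
  | While bexp com

primrec aval :: "aexp \<Rightarrow> state \<Rightarrow> nat" where
  "aval (Num k) s = k"
| "aval (Reg r) s = fst s r"
| "aval (Mem a) s = snd s (aval a s)"
| "aval (Plus a b) s = aval a s + aval b s"
| "aval (Minus a b) s = aval a s - aval b s"

primrec bval :: "bexp \<Rightarrow> state \<Rightarrow> bool" where
  "bval (Less a b) s \<longleftrightarrow> aval a s < aval b s"
| "bval (Not b) s \<longleftrightarrow> \<not> bval b s"
| "bval (And b1 b2) s \<longleftrightarrow> bval b1 s \<and> bval b2 s"

definition set_reg :: "nat \<Rightarrow> nat \<Rightarrow> state \<Rightarrow> state" where
  "set_reg r v s = ((fst s)(r := v), snd s)"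

definition set_mem :: "nat \<Rightarrow> nat \<Rightarrow> state \<Rightarrow> state" where
  "set_mem a v s = (fst s, (snd s)(a := v))"

text \<open>One small step; \<^term>\<open>Skip\<close> is the halted program and is absorbing.\<close>

primrec step :: "com \<Rightarrow> state \<Rightarrow> (com \<times> state) pmf" where
  "step Skip s = return_pmf (Skip, s)"
| "step (Assign r a) s = return_pmf (Skip, set_reg r (aval a s) s)"
| "step (Store a b) s = return_pmf (Skip, set_mem (aval a s) (aval b s) s)"
| "step (Flip r) s =
     map_pmf (\<lambda>b. (Skip, set_reg r (of_bool b) s)) (bernoulli_pmf (1 / 2))"
| "step (Seq c1 c2) s =
     (if c1 = Skip then return_pmf (c2, s)
      else map_pmf (\<lambda>(c, s'). (Seq c c2, s')) (step c1 s))"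
| "step (Cond b c1 c2) s = return_pmf (if bval b s then c1 else c2, s)"
| "step (While b c) s = return_pmf (if bval b s then Seq c (While b c) else Skip, s)"

primrec steps :: "nat \<Rightarrow> com \<times> state \<Rightarrow> (com \<times> state) pmf" where
  "steps 0 cfg = return_pmf cfg"
| "steps (Suc t) cfg = bind_pmf (step (fst cfg) (snd cfg)) (steps t)"

definition initial :: "nat list \<Rightarrow> state" where
  "initial x = ((\<lambda>_. 0), (\<lambda>a. if a < length x then x ! a else 0))"

definition run :: "com \<Rightarrow> nat list \<Rightarrow> nat \<Rightarrow> (com \<times> state) pmf" where
  "run P x t = steps t (P, initial x)"

text \<open>Worst case over all outcomes of the coin.\<close>

definition halts_within :: "com \<Rightarrow> nat list \<Rightarrow> nat \<Rightarrow> bool" where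
  "halts_within P x t \<longleftrightarrow> (\<forall>cfg\<in>set_pmf (run P x t). fst cfg = Skip)"


section \<open>Inputs and outputs\<close>

text \<open>
  To become an input, an instance is presented through an enumeration \<open>e\<close> of its elements and an
  enumeration \<open>u\<close> of its sets: the three sizes, followed by one row of bits for each set, listing
  which elements it contains and which of the families \<open>S 1, \<dots>, S (levels U)\<close> it belongs to.
\<close>

definition encode ::
  "'a set \<Rightarrow> 'a set set \<Rightarrow> (nat \<Rightarrow> 'a set set) \<Rightarrow> (nat \<Rightarrow> 'a) \<Rightarrow> (nat \<Rightarrow> 'a set) \<Rightarrow> nat list"
  where
  "encode A U S e u =
     [card U, card A, levels U] @
     concat (map (\<lambda>j. map (\<lambda>k. of_bool (e k \<in> u j)) [0..<card A] @
                      map (\<lambda>i. of_bool (u j \<in> S i)) [1..<levels U + 1])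
                 [0..<card U])"

text \<open>The first \<open>card U\<close> memory cells of the final state are the indicator vector of the output.\<close>

definition decode :: "'a set set \<Rightarrow> (nat \<Rightarrow> 'a set) \<Rightarrow> state \<Rightarrow> 'a set set" where
  "decode U u s = {u j |j. j < card U \<and> snd s j \<noteq> 0}"

end

theory Submission imports Defs begin

text \<open>
  No coins are needed. A round runs through the levels \<open>i\<close> and makes \<open>2 ^ i\<close> greedy picks from
  \<open>S i\<close>, each time a set that covers most uncovered elements. The at most \<open>2 ^ i\<close> sets of a
  \<open>1\<close>-valid solution in \<open>S i\<close> can be charged injectively to these picks. Sets outside all budgeted
  families are taken for free, so what is still uncovered after the round is at most what the round
  has covered: each round at least halves the number of uncovered elements. If
  \<open>card A \<le> card U ^ d\<close>, then \<open>d * levels U + 1\<close> rounds cover everything and use at most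
  \<open>(d * levels U + 1) * 2 ^ i\<close> sets of \<open>S i\<close>.

  The factor \<open>c\<close> may depend on \<open>card U\<close> only, while \<open>A\<close> can be arbitrarily large. Therefore the
  greedy result is followed by an exhaustive search that starts from it; the search stops
  at once if \<open>card A \<le> card U ^ d\<close>, and otherwise it may take exponential time.
\<close>

section \<open>Reasoning about coin-free programs\<close>

text \<open>Coins have no rule here, so only runs without \<open>Flip\<close> are derivable. The
  counts agree with \<open>step\<close>: in \<open>Seq\<close>, and after each loop body, one extra
  step discards the finished \<open>Skip\<close>.\<close>

inductive exec :: "com \<Rightarrow> state \<Rightarrow> nat \<Rightarrow> state \<Rightarrow> bool" where
  Skip: "exec Skip s 0 s"
| Assign: "exec (Assign r a) s 1 (set_reg r (aval a s) s)"
| Store: "exec (Store a b) s 1 (set_mem (aval a s) (aval b s) s)"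
| Seq: "exec c1 s t1 s1 \<Longrightarrow> exec c2 s1 t2 s2 \<Longrightarrow> exec (Seq c1 c2) s (t1 + Suc t2) s2"
| CondT: "bval b s \<Longrightarrow> exec c1 s t s' \<Longrightarrow> exec (Cond b c1 c2) s (Suc t) s'"
| CondF: "\<not> bval b s \<Longrightarrow> exec c2 s t s' \<Longrightarrow> exec (Cond b c1 c2) s (Suc t) s'"
| WhileF: "\<not> bval b s \<Longrightarrow> exec (While b c) s 1 s"
| WhileT: "bval b s \<Longrightarrow> exec c s t1 s1 \<Longrightarrow> exec (While b c) s1 t2 s2 \<Longrightarrow>
    exec (While b c) s (Suc (t1 + Suc t2)) s2"

lemma exec_iffs:
  "exec Skip s t s' \<longleftrightarrow> t = 0 \<and> s' = s"
  "exec (Assign r a) s t s' \<longleftrightarrow> t = 1 \<and> s' = set_reg r (aval a s) s"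
  "exec (Store a b) s t s' \<longleftrightarrow> t = 1 \<and> s' = set_mem (aval a s) (aval b s) s"
  "exec (Seq c1 c2) s t s' \<longleftrightarrow>
     (\<exists>t1 s1 t2. exec c1 s t1 s1 \<and> exec c2 s1 t2 s' \<and> t = t1 + Suc t2)"
  "exec (Cond e c1 c2) s t s' \<longleftrightarrow>
     (\<exists>t1. (if bval e s then exec c1 s t1 s' else exec c2 s t1 s') \<and> t = Suc t1)"
  by (subst exec.simps; force)+

lemma exec_While_iff:
  "exec (While e c) s t s' \<longleftrightarrow>
     (if bval e s then (\<exists>t1 s1 t2. exec c s t1 s1 \<and> exec (While e c) s1 t2 s' \<and> t = Suc (t1 + Suc t2))
      else t = 1 \<and> s' = s)"
  by (subst exec.simps) force

section \<open>Small-step traces through point masses\<close>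

inductive reach :: "nat \<Rightarrow> com \<times> state \<Rightarrow> com \<times> state \<Rightarrow> bool" where
  reach_0: "reach 0 x x"
| reach_Suc: "c \<noteq> Skip \<Longrightarrow> step c s = return_pmf y \<Longrightarrow> reach t y z \<Longrightarrow> reach (Suc t) (c, s) z"

lemma reach_trans: "reach t1 x y \<Longrightarrow> reach t2 y z \<Longrightarrow> reach (t1 + t2) x z"
  by (induction rule: reach.induct) (auto intro: reach.intros)

text \<open>This is why \<open>reach\<close> never idles in \<open>Skip\<close>, although
  \<open>step\<close> would stay there: \<open>Seq Skip c2\<close> moves on to \<open>c2\<close>, so
  idle steps of the first component could not be replayed inside a sequence.\<close>

lemma reach_Seq:
  assumes "reach t x y"
  shows "reach t (Seq (fst x) c2, snd x) (Seq (fst y) c2, snd y)"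
  using assms
proof (induction rule: reach.induct)
  case (reach_Suc c s y t z)
  have "step (Seq c c2) s = return_pmf (Seq (fst y) c2, snd y)"
    using reach_Suc by (simp add: case_prod_beta)
  then show ?case
    using reach_Suc by (auto intro!: reach.reach_Suc)
qed (rule reach_0)

lemma reach_steps: "reach t x z \<Longrightarrow> steps t x = return_pmf z"
  by (induction rule: reach.induct) (auto simp: bind_return_pmf)

lemma exec_reach: "exec c s t s' \<Longrightarrow> reach t (c, s) (Skip, s')"
proof (induction rule: exec.induct)
  case (Seq c1 s t1 s1 c2 t2 s2)
  have "reach t1 (Seq c1 c2, s) (Seq Skip c2, s1)"
    using reach_Seq[OF Seq.IH(1), of c2] by simp
  moreover have "reach (Suc t2) (Seq Skip c2, s1) (Skip, s2)"
    using Seq.IH(2) by (auto intro: reach.intros)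
  ultimately show ?case
    by (rule reach_trans)
next
  case (WhileT b s c t1 s1 t2 s2)
  have "reach t1 (Seq c (While b c), s) (Seq Skip (While b c), s1)"
    using reach_Seq[OF WhileT.IH(1), of "While b c"] by simp
  moreover have "reach (Suc t2) (Seq Skip (While b c), s1) (Skip, s2)"
    using WhileT.IH(2) by (auto intro: reach.intros)
  ultimately have "reach (t1 + Suc t2) (Seq c (While b c), s) (Skip, s2)"
    by (rule reach_trans)
  then show ?case
    using WhileT.hyps(1) by (auto intro: reach.intros)
qed (auto intro!: reach.intros)

lemma exec_steps: "exec c s t s' \<Longrightarrow> steps t (c, s) = return_pmf (Skip, s')"
  by (intro reach_steps exec_reach)

section \<open>Frame conditions and weakest preconditions\<close>

primrec writes :: "com \<Rightarrow> nat set" where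
  "writes Skip = {}"
| "writes (Assign r a) = {r}"
| "writes (Store a b) = {}"
| "writes (Flip r) = {r}"
| "writes (Seq c1 c2) = writes c1 \<union> writes c2"
| "writes (Cond b c1 c2) = writes c1 \<union> writes c2"
| "writes (While b c) = writes c"

primrec storeless :: "com \<Rightarrow> bool" where
  "storeless Skip \<longleftrightarrow> True"
| "storeless (Assign r a) \<longleftrightarrow> True"
| "storeless (Store a b) \<longleftrightarrow> False"
| "storeless (Flip r) \<longleftrightarrow> True"
| "storeless (Seq c1 c2) \<longleftrightarrow> storeless c1 \<and> storeless c2"
| "storeless (Cond b c1 c2) \<longleftrightarrow> storeless c1 \<and> storeless c2"
| "storeless (While b c) \<longleftrightarrow> storeless c"

lemma exec_writes: "exec c s t s' \<Longrightarrow> r \<notin> writes c \<Longrightarrow> fst s' r = fst s r"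
  by (induction rule: exec.induct) (auto simp: set_reg_def set_mem_def)

lemma exec_storeless: "exec c s t s' \<Longrightarrow> storeless c \<Longrightarrow> snd s' = snd s"
  by (induction rule: exec.induct) (auto simp: set_reg_def)

text \<open>Existence of a run makes this total correctness, and the postcondition sees the step
  count, so correctness and running time are proved together.\<close>

definition wp :: "com \<Rightarrow> (nat \<Rightarrow> state \<Rightarrow> bool) \<Rightarrow> state \<Rightarrow> bool" where
  "wp c Q s \<longleftrightarrow> (\<exists>t s'. exec c s t s' \<and> Q t s')"

lemma wp_Skip [simp]: "wp Skip Q = Q 0"
  by (auto simp: fun_eq_iff wp_def exec_iffs)

lemma wp_Assign [simp]: "wp (Assign r a) Q = (\<lambda>s. Q 1 (set_reg r (aval a s) s))"
  by (auto simp: fun_eq_iff wp_def exec_iffs)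

lemma wp_Store [simp]: "wp (Store a b) Q = (\<lambda>s. Q 1 (set_mem (aval a s) (aval b s) s))"
  by (auto simp: fun_eq_iff wp_def exec_iffs)

lemma wp_Seq: "wp (Seq c1 c2) Q s \<longleftrightarrow> wp c1 (\<lambda>t1. wp c2 (\<lambda>t2. Q (t1 + Suc t2))) s"
  unfolding wp_def exec_iffs by blast

lemma wp_Cond [simp]:
  "wp (Cond b c1 c2) Q =
     (\<lambda>s. if bval b s then wp c1 (\<lambda>t. Q (Suc t)) s else wp c2 (\<lambda>t. Q (Suc t)) s)"
  unfolding wp_def exec_iffs fun_eq_iff by auto

lemma wp_While:
  "wp (While b c) Q s \<longleftrightarrow>
     (if bval b s then wp c (\<lambda>t1. wp (While b c) (\<lambda>t2. Q (Suc (t1 + Suc t2)))) s else Q 1 s)"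
proof (cases "bval b s")
  case True
  then show ?thesis
    unfolding wp_def by (subst exec_While_iff) (simp, blast)
next
  case False
  then show ?thesis
    unfolding wp_def by (subst exec_While_iff) simp
qed

definition frame :: "com \<Rightarrow> state \<Rightarrow> state \<Rightarrow> bool" where
  "frame c s s' \<longleftrightarrow> (\<forall>r. r \<notin> writes c \<longrightarrow> fst s' r = fst s r) \<and> (storeless c \<longrightarrow> snd s' = snd s)"

text \<open>Every consequence step also yields the syntactic frame, so invariants need not list what
  a program leaves unchanged.\<close>

lemma wp_mono:
  assumes "wp c Q s" and "\<And>t s'. Q t s' \<Longrightarrow> frame c s s' \<Longrightarrow> Q' t s'"
  shows "wp c Q' s"
  using assms unfolding wp_def frame_def by (metis exec_storeless exec_writes)

lemma wp_SeqI:
  assumes "wp c1 Q1 s"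
    and "\<And>t1 s1. Q1 t1 s1 \<Longrightarrow> frame c1 s s1 \<Longrightarrow> wp c2 (\<lambda>t2. Q (t1 + Suc t2)) s1"
  shows "wp (Seq c1 c2) Q s"
  using assms(1) unfolding wp_Seq by (rule wp_mono) (rule assms(2))

section \<open>Counting loops with time bounds\<close>

definition For :: "nat \<Rightarrow> nat \<Rightarrow> com \<Rightarrow> com" where
  "For j b c = Seq (Assign j (Num 0))
     (While (Less (Reg j) (Reg b)) (Seq c (Assign j (Plus (Reg j) (Num 1)))))"

lemma writes_For [simp]: "writes (For j b c) = insert j (writes c)"
  by (auto simp: For_def)

lemma storeless_For [simp]: "storeless (For j b c) = storeless c"
  by (auto simp: For_def)

text \<open>Three steps pay for initialising the counter, discarding the resulting
  \<open>Skip\<close> and the last test; four per iteration pay for the test, the increment and two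
  discarded \<open>Skip\<close> commands.\<close>

definition loop_time :: "nat \<Rightarrow> nat \<Rightarrow> nat" where
  "loop_time K B = 3 + K * (B + 4)"

text \<open>Induction on the number of remaining iterations. \<open>stable\<close> makes the
  invariant insensitive to the counter, because the increment comes after the body has already
  established \<open>Inv (Suc i)\<close>. The frame hands the body whatever the loop has left
  unchanged since its start.\<close>

lemma wp_For:
  assumes n: "fst s b = n" "n \<le> K" and wr: "b \<noteq> j" "b \<notin> writes c" "j \<notin> writes c"
    and init: "Inv 0 s"
    and stable: "\<And>i s v. Inv i s \<Longrightarrow> Inv i (set_reg j v s)"
    and body: "\<And>i s'. i < n \<Longrightarrow> Inv i s' \<Longrightarrow> fst s' j = i \<Longrightarrow> frame (For j b c) s s' \<Longrightarrow>
      wp c (\<lambda>t s''. t \<le> B \<and> Inv (Suc i) s'') s'"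
  shows "wp (For j b c) (\<lambda>t s'. t \<le> loop_time K B \<and> Inv n s') s"
proof -
  let ?W = "While (Less (Reg j) (Reg b)) (Seq c (Assign j (Plus (Reg j) (Num 1))))"
  have loop: "wp ?W (\<lambda>t s''. t \<le> 1 + (n - i) * (B + 4) \<and> Inv n s'') s'"
    if "i \<le> n" "Inv i s'" "fst s' j = i" "frame (For j b c) s s'" for i s'
    using that
  proof (induction "n - i" arbitrary: i s')
    case 0
    then show ?case
      using n wr by (subst wp_While) (auto simp: frame_def)
  next
    case (Suc k)
    have lt: "i < n" and b: "fst s' b = n"
      using Suc.hyps Suc.prems n wr by (auto simp: frame_def)
    have "wp c (\<lambda>t1 s1. wp (Assign j (Plus (Reg j) (Num 1)))
        (\<lambda>t2. wp ?W (\<lambda>t3 s''. Suc (t1 + Suc t2 + Suc t3) \<le> 1 + (n - i) * (B + 4) \<and> Inv n s'')) s1) s'"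
      using body[OF lt Suc.prems(2-4)]
    proof (rule wp_mono)
      fix t1 s1
      assume s1: "t1 \<le> B \<and> Inv (Suc i) s1" and fr: "frame c s' s1"
      have ji: "fst s1 j = i"
        using fr Suc.prems(3) wr by (auto simp: frame_def)
      have fr': "frame (For j b c) s (set_reg j (Suc i) s1)"
        using fr Suc.prems(4) wr by (auto simp: frame_def set_reg_def)
      have "wp ?W (\<lambda>t s''. t \<le> 1 + (n - Suc i) * (B + 4) \<and> Inv n s'') (set_reg j (Suc i) s1)"
      proof (rule Suc.hyps(1))
        show "Inv (Suc i) (set_reg j (Suc i) s1)"
          using s1 by (intro stable) simp
      qed (use lt fr' Suc.hyps(2) in \<open>auto simp: set_reg_def\<close>)
      then have "wp ?W (\<lambda>t3 s''. Suc (t1 + Suc 1 + Suc t3) \<le> 1 + (n - i) * (B + 4) \<and> Inv n s'')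
          (set_reg j (Suc i) s1)"
      proof (rule wp_mono)
        fix t s'' assume *: "t \<le> 1 + (n - Suc i) * (B + 4) \<and> Inv n s''"
        obtain q where "n = Suc (i + q)"
          using lt less_iff_Suc_add by auto
        then show "Suc (t1 + Suc 1 + Suc t) \<le> 1 + (n - i) * (B + 4) \<and> Inv n s''"
          using * s1 by (auto simp: algebra_simps)
      qed
      then show "wp (Assign j (Plus (Reg j) (Num 1)))
        (\<lambda>t2. wp ?W (\<lambda>t3 s''. Suc (t1 + Suc t2 + Suc t3) \<le> 1 + (n - i) * (B + 4) \<and> Inv n s'')) s1"
        using ji by simp
    qed
    then show ?case
      using lt b Suc.prems(3) by (subst wp_While) (simp add: wp_Seq)
  qed
  have "wp ?W (\<lambda>t s''. t \<le> 1 + (n - 0) * (B + 4) \<and> Inv n s'') (set_reg j 0 s)"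
    using init by (intro loop stable) (auto simp: frame_def set_reg_def)
  then have "wp ?W (\<lambda>t s''. 1 + Suc t \<le> loop_time K B \<and> Inv n s'') (set_reg j 0 s)"
  proof (rule wp_mono)
    fix t s'' assume *: "t \<le> 1 + (n - 0) * (B + 4) \<and> Inv n s''"
    have "n * (B + 4) \<le> K * (B + 4)"
      using n by (intro mult_right_mono) auto
    then show "1 + Suc t \<le> loop_time K B \<and> Inv n s''"
      using * unfolding loop_time_def minus_nat.diff_0 by (elim conjE, intro conjI) linarith+
  qed
  then show ?thesis
    by (simp add: For_def wp_Seq)
qed

section \<open>Greedy covering under level budgets\<close>

text \<open>Levels are counted from \<open>0\<close> here: \<open>V j i\<close> says that set \<open>j\<close> belongs to \<open>S (Suc i)\<close>.\<close>

locale cover_instance =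
  fixes n m T :: nat and C V :: "nat \<Rightarrow> nat \<Rightarrow> bool"
  assumes level_unique: "j < n \<Longrightarrow> i < T \<Longrightarrow> i' < T \<Longrightarrow> V j i \<Longrightarrow> V j i' \<Longrightarrow> i = i'"
begin

definition level :: "nat \<Rightarrow> nat set" where
  "level i = {j. j < n \<and> V j i}"

definition free :: "nat set" where
  "free = {j. j < n \<and> (\<forall>i<T. \<not> V j i)}"

definition uncovered :: "nat set \<Rightarrow> nat set" where
  "uncovered X = {k. k < m \<and> \<not> (\<exists>j\<in>X. C j k)}"

definition gain :: "nat set \<Rightarrow> nat \<Rightarrow> nat" where
  "gain X j = card {k \<in> uncovered X. C j k}"

definition in_budget :: "nat \<Rightarrow> nat set \<Rightarrow> bool" where
  "in_budget c X \<longleftrightarrow> (\<forall>i<T. card (X \<inter> level i) \<le> c * 2 ^ Suc i)"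

definition solution :: "nat \<Rightarrow> nat set \<Rightarrow> bool" where
  "solution c X \<longleftrightarrow> X \<subseteq> {..<n} \<and> uncovered X = {} \<and> in_budget c X"

text \<open>A relation, so the choice among ties stays open: coverage must improve by at least the
  old gain of each candidate. \<open>X' = X\<close> is possible only when no candidate gains
  anything.\<close>

definition greedy_step :: "nat \<Rightarrow> nat set \<Rightarrow> nat set \<Rightarrow> bool" where
  "greedy_step i X X' \<longleftrightarrow> (X' = X \<or> (\<exists>b\<in>level i. X' = insert b X)) \<and>
     (\<forall>j\<in>level i. card (uncovered X') + gain X j \<le> card (uncovered X))"

primrec greedy_levels :: "nat \<Rightarrow> nat set \<Rightarrow> nat set \<Rightarrow> bool" where
  "greedy_levels 0 = (=)"
| "greedy_levels (Suc i) = greedy_levels i OO (greedy_step i ^^ (2 ^ Suc i))"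

section \<open>Monotonicity of coverage and gain\<close>

lemma finite_uncovered [simp]: "finite (uncovered X)"
  by (simp add: uncovered_def)

lemma finite_level [simp]: "finite (level i)"
  by (simp add: level_def)

lemma uncovered_antimono: "X \<subseteq> Y \<Longrightarrow> uncovered Y \<subseteq> uncovered X"
  by (auto simp: uncovered_def)

lemma card_uncovered_antimono: "X \<subseteq> Y \<Longrightarrow> card (uncovered Y) \<le> card (uncovered X)"
  by (intro card_mono uncovered_antimono) auto

lemma gain_antimono: "X \<subseteq> Y \<Longrightarrow> gain Y j \<le> gain X j"
  unfolding gain_def using uncovered_antimono by (intro card_mono) auto

lemma gain_insert: "card (uncovered (insert j X)) + gain X j = card (uncovered X)"
proof -
  have "uncovered X = uncovered (insert j X) \<union> {k \<in> uncovered X. C j k}"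
    by (auto simp: uncovered_def)
  then have "card (uncovered X) = card (uncovered (insert j X) \<union> {k \<in> uncovered X. C j k})"
    by simp
  also have "\<dots> = card (uncovered (insert j X)) + gain X j"
    unfolding gain_def by (rule card_Un_disjoint) (auto simp: uncovered_def)
  finally show ?thesis ..
qed

lemma greedy_step_mono: "greedy_step i X X' \<Longrightarrow> X \<subseteq> X'"
  by (auto simp: greedy_step_def)

lemma greedy_steps_mono: "(greedy_step i ^^ q) X X' \<Longrightarrow> X \<subseteq> X'"
  by (induction q arbitrary: X') (auto dest: greedy_step_mono)

text \<open>
  Charge the elements of \<open>Q\<close> injectively to the steps: when a step was taken, the element charged
  to it was a candidate, and its gain was at least as large as it is at the end.
\<close>

lemma greedy_steps_gain:
  assumes "(greedy_step i ^^ q) X X'" and "Q \<subseteq> level i" and "card Q \<le> q"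
  shows "card (uncovered X') + (\<Sum>j\<in>Q. gain X' j) \<le> card (uncovered X)"
  using assms
proof (induction q arbitrary: X' Q)
  case 0
  then have "Q = {}"
    using finite_subset[OF _ finite_level] by auto
  with 0 show ?case by simp
next
  case (Suc q)
  then obtain Y where Y: "(greedy_step i ^^ q) X Y" "greedy_step i Y X'"
    by auto
  note YX' = greedy_step_mono[OF Y(2)]
  show ?case
  proof (cases "Q = {}")
    case True
    then show ?thesis
      using card_uncovered_antimono[of X X'] greedy_steps_mono[OF Suc.prems(1)] by auto
  next
    case False
    then obtain j where j: "j \<in> Q" by auto
    have fin: "finite Q"
      using Suc.prems(2) finite_subset[OF _ finite_level] by auto
    \<comment> \<open>The last step pays for an arbitrary \<open>j\<close> of \<open>Q\<close>, the
      \<open>q\<close> earlier ones pay for the remaining elements.\<close>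
    have "card (uncovered Y) + (\<Sum>j\<in>Q - {j}. gain Y j) \<le> card (uncovered X)"
      using Suc.prems j fin by (intro Suc.IH[OF Y(1)]) auto
    moreover have "card (uncovered X') + gain Y j \<le> card (uncovered Y)"
      using Y(2) Suc.prems(2) j by (auto simp: greedy_step_def)
    moreover have "(\<Sum>j\<in>Q - {j}. gain X' j) \<le> (\<Sum>j\<in>Q - {j}. gain Y j)"
      by (intro sum_mono gain_antimono YX')
    moreover have "gain X' j \<le> gain Y j"
      by (intro gain_antimono YX')
    ultimately show ?thesis
      using sum.remove[OF fin j, of "gain X'"] by linarith
  qed
qed

lemma greedy_steps_card:
  assumes "(greedy_step i ^^ q) X X'"
  shows "X' - X \<subseteq> level i" and "card (X' - X) \<le> q"
proof -
  have "X' - X \<subseteq> level i \<and> card (X' - X) \<le> q"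
    using assms
  proof (induction q arbitrary: X')
    case (Suc q)
    then obtain Y where Y: "(greedy_step i ^^ q) X Y" "greedy_step i Y X'"
      by auto
    note IH = Suc.IH[OF Y(1)]
    from Y(2) consider "X' = Y" | b where "b \<in> level i" "X' = insert b Y"
      by (auto simp: greedy_step_def)
    then show ?case
    proof cases
      case 2
      have "X' - X \<subseteq> insert b (Y - X)"
        using 2 by auto
      moreover have "card (insert b (Y - X)) \<le> Suc (card (Y - X))"
        by (simp add: card_insert_le_m1)
      moreover have "finite (Y - X)"
        using IH finite_subset[OF _ finite_level] by blast
      ultimately show ?thesis
        using IH 2 by (meson card_mono dual_order.trans finite_insert insert_subset Suc_le_mono)
    qed (use IH in auto)
  qed simp
  then show "X' - X \<subseteq> level i" and "card (X' - X) \<le> q" by auto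
qed

section \<open>One greedy pass over the levels\<close>

lemma greedy_levels_mono: "greedy_levels i X X' \<Longrightarrow> X \<subseteq> X'"
proof (induction i arbitrary: X')
  case (Suc i)
  then obtain Y where "greedy_levels i X Y" "(greedy_step i ^^ (2 ^ Suc i)) Y X'"
    by (auto simp del: power_Suc relpowp.simps)
  then show ?case
    using Suc.IH greedy_steps_mono by blast
qed auto

lemma level_disjoint: "i < T \<Longrightarrow> i' < T \<Longrightarrow> i \<noteq> i' \<Longrightarrow> level i \<inter> level i' = {}"
  using level_unique by (auto simp: level_def)

text \<open>The first conjunct drives the induction: so far only sets of lower levels were added,
  and by disjointness none of them counts against the budget of the level treated next.\<close>

lemma greedy_levels_card:
  assumes "greedy_levels i X X'" "i \<le> T"
  shows "X' - X \<subseteq> (\<Union>i'<i. level i') \<and> (\<forall>i'<T. card ((X' - X) \<inter> level i') \<le> 2 ^ Suc i')"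
  using assms
proof (induction i arbitrary: X')
  case (Suc i)
  then obtain Y where Y: "greedy_levels i X Y" "(greedy_step i ^^ (2 ^ Suc i)) Y X'"
    by (auto simp del: power_Suc relpowp.simps)
  note IH = Suc.IH[OF Y(1)] and st = greedy_steps_card[OF Y(2)]
  have XY: "X' - X \<subseteq> (Y - X) \<union> (X' - Y)"
    by auto
  have sub: "X' - X \<subseteq> (\<Union>i'<Suc i. level i')"
    using XY IH st(1) Suc.prems(2) by (auto simp: lessThan_Suc)
  have "card ((X' - X) \<inter> level i') \<le> 2 ^ Suc i'" if "i' < T" for i'
  proof (cases "i' = i")
    case True
    have "level i' \<inter> level i = {}" if "i' < i" for i'
      using level_disjoint[of i' i] Suc.prems(2) that by simp
    then have "(Y - X) \<inter> level i = {}"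
      using IH Suc.prems(2) by fastforce
    then have "(X' - X) \<inter> level i' \<subseteq> X' - Y"
      using XY True by auto
    moreover have "finite (X' - Y)"
      using st(1) finite_subset[OF _ finite_level] by blast
    ultimately show ?thesis
      using st(2) True by (meson card_mono le_trans)
  next
    case False
    have "(X' - Y) \<inter> level i' = {}"
      using st(1) level_disjoint[of i i'] Suc.prems(2) that False by auto
    then have "(X' - X) \<inter> level i' \<subseteq> (Y - X) \<inter> level i'"
      using XY by auto
    then have "card ((X' - X) \<inter> level i') \<le> card ((Y - X) \<inter> level i')"
      by (intro card_mono) auto
    then show ?thesis
      using IH Suc.prems(2) that by (meson Suc_leD dual_order.trans)
  qed
  with sub show ?case by blast
qed auto

text \<open>The charging argument applies to each level separately. Gains only shrink as the
  selection grows, so the charges of earlier levels remain valid at the final \<open>X'\<close>;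
  disjointness of the levels lets the sums be added.\<close>

lemma greedy_levels_gain:
  assumes "greedy_levels i X X'" "i \<le> T" and Opt: "finite Opt" "in_budget 1 Opt"
  shows "card (uncovered X') + (\<Sum>j\<in>(\<Union>i'<i. Opt \<inter> level i'). gain X' j) \<le> card (uncovered X)"
  using assms(1,2)
proof (induction i arbitrary: X')
  case (Suc i)
  then obtain Y where Y: "greedy_levels i X Y" "(greedy_step i ^^ (2 ^ Suc i)) Y X'"
    by (auto simp del: power_Suc relpowp.simps)
  let ?G = "\<Union>i'<i. Opt \<inter> level i'"
  have "card (Opt \<inter> level i) \<le> 2 ^ Suc i"
    using Opt Suc.prems(2) by (auto simp: in_budget_def)
  then have "card (uncovered X') + (\<Sum>j\<in>Opt \<inter> level i. gain X' j) \<le> card (uncovered Y)"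
    by (intro greedy_steps_gain[OF Y(2)]) auto
  moreover have "card (uncovered Y) + (\<Sum>j\<in>?G. gain Y j) \<le> card (uncovered X)"
    using Suc.prems(2) by (intro Suc.IH Y) auto
  moreover have "(\<Sum>j\<in>?G. gain X' j) \<le> (\<Sum>j\<in>?G. gain Y j)"
    using greedy_steps_mono[OF Y(2)] by (intro sum_mono gain_antimono)
  moreover have "(\<Sum>j\<in>(\<Union>i'<Suc i. Opt \<inter> level i'). gain X' j)
      = (\<Sum>j\<in>Opt \<inter> level i. gain X' j) + (\<Sum>j\<in>?G. gain X' j)"
  proof -
    have "level i \<inter> level i' = {}" if "i' < i" for i'
      using level_disjoint[of i i'] Suc.prems(2) that by simp
    then have "(Opt \<inter> level i) \<inter> ?G = {}"
      by auto
    then show ?thesis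
      using Opt(1) by (simp add: lessThan_Suc sum.union_disjoint)
  qed
  ultimately show ?case by linarith
qed auto

lemma greedy_round_halves:
  assumes X: "greedy_levels T X X'" "free \<subseteq> X" and Opt: "solution 1 Opt"
  shows "2 * card (uncovered X') \<le> card (uncovered X)"
proof -
  let ?G = "\<Union>i<T. Opt \<inter> level i"
  have fin: "finite Opt"
    using Opt finite_subset[of Opt] by (auto simp: solution_def)
  have "free \<subseteq> X'"
    using greedy_levels_mono[OF X(1)] X(2) by auto
  \<comment> \<open>An element missed by \<open>X'\<close> lies in some set of \<open>Opt\<close>.
    That set is not free, because \<open>X'\<close> contains all free sets, so it belongs to a
    level.\<close>
  then have "uncovered X' \<subseteq> (\<Union>j\<in>?G. {k \<in> uncovered X'. C j k})"
    using Opt by (fastforce simp: uncovered_def solution_def free_def level_def)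
  then have "card (uncovered X') \<le> card (\<Union>j\<in>?G. {k \<in> uncovered X'. C j k})"
    using fin by (intro card_mono) auto
  also have "\<dots> \<le> (\<Sum>j\<in>?G. gain X' j)"
    unfolding gain_def using fin by (intro card_UN_le) auto
  finally show ?thesis
    using greedy_levels_gain[OF X(1) order_refl fin] Opt by (auto simp: solution_def)
qed

section \<open>Iterated greedy rounds\<close>

lemma greedy_rounds:
  assumes "(greedy_levels T ^^ r) free X" and "solution 1 Opt"
  shows "free \<subseteq> X \<and> X \<subseteq> {..<n} \<and> 2 ^ r * card (uncovered X) \<le> m \<and> in_budget r X"
  using assms(1)
proof (induction r arbitrary: X)
  case 0
  have "card (uncovered X) \<le> card {..<m}"
    by (intro card_mono) (auto simp: uncovered_def)
  \<comment> \<open>Free sets lie in no level, so the start spends no budget.\<close>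
  moreover have "free \<inter> level i = {}" if "i < T" for i
    using that by (auto simp: free_def level_def)
  ultimately show ?case
    using 0 by (auto simp: in_budget_def free_def)
next
  case (Suc r)
  then obtain Y where Y: "(greedy_levels T ^^ r) free Y" "greedy_levels T Y X"
    by auto
  note IH = Suc.IH[OF Y(1)] and lv = greedy_levels_card[OF Y(2) order_refl]
    and mono = greedy_levels_mono[OF Y(2)]
  have "2 ^ Suc r * card (uncovered X) = 2 ^ r * (2 * card (uncovered X))"
    by simp
  also have "\<dots> \<le> 2 ^ r * card (uncovered Y)"
    using greedy_round_halves[OF Y(2) _ assms(2)] IH by (intro mult_left_mono) auto
  finally have "2 ^ Suc r * card (uncovered X) \<le> m"
    by (rule order_trans) (use IH in auto)
  moreover have "X \<subseteq> {..<n}"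
    using lv IH by (fastforce simp: level_def)
  moreover have "card (X \<inter> level i) \<le> Suc r * 2 ^ Suc i" if "i < T" for i
  proof -
    have "X \<inter> level i = (Y \<inter> level i) \<union> ((X - Y) \<inter> level i)"
      using mono by auto
    then have "card (X \<inter> level i) \<le> card (Y \<inter> level i) + card ((X - Y) \<inter> level i)"
      by (metis card_Un_le)
    moreover have "card (Y \<inter> level i) \<le> r * 2 ^ Suc i" "card ((X - Y) \<inter> level i) \<le> 2 ^ Suc i"
      using that IH lv by (auto simp: in_budget_def simp del: power_Suc)
    ultimately show ?thesis
      by (simp del: power_Suc)
  qed
  ultimately show ?case
    using IH mono by (auto simp: in_budget_def)
qed

text \<open>With \<open>m < 2 ^ r\<close>, a single uncovered element would already violate
  \<open>2 ^ r * card (uncovered X) \<le> m\<close>.\<close>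

lemma greedy_solution:
  assumes "(greedy_levels T ^^ r) free X" and "solution 1 Opt" and "m < 2 ^ r"
  shows "solution r X"
proof -
  note * = greedy_rounds[OF assms(1,2)]
  then have "card (uncovered X) = 0"
    using assms(3) by (metis le_trans linorder_not_less mult.right_neutral mult_le_mono2 not_gr_zero Suc_leI One_nat_def)
  then show ?thesis
    using * by (auto simp: solution_def)
qed

lemma solution_mono: "solution c X \<Longrightarrow> c \<le> c' \<Longrightarrow> solution c' X"
  unfolding solution_def in_budget_def by (meson mult_le_mono1 order_trans)

end

section \<open>The program\<close>

text \<open>Registers from \<open>rN\<close> to \<open>rRounds\<close> stay fixed after loading and
  those above are scratch, so \<open>rRounds < r\<close> singles out registers that may change
  freely.\<close>

abbreviation (input) "rN \<equiv> 2::nat"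
abbreviation (input) "rM \<equiv> 3::nat"
abbreviation (input) "rT \<equiv> 4::nat"
abbreviation (input) "rWidth \<equiv> 5::nat"
abbreviation (input) "rBase \<equiv> 6::nat"
abbreviation (input) "rRounds \<equiv> 7::nat"
abbreviation (input) "rK \<equiv> 8::nat"
abbreviation (input) "rJ' \<equiv> 9::nat"
abbreviation (input) "rRow' \<equiv> 10::nat"
abbreviation (input) "rCov \<equiv> 11::nat"
abbreviation (input) "rRow \<equiv> 12::nat"
abbreviation (input) "rGain \<equiv> 13::nat"
abbreviation (input) "rI \<equiv> 14::nat"
abbreviation (input) "rBest \<equiv> 15::nat"
abbreviation (input) "rBestGain \<equiv> 16::nat"
abbreviation (input) "rJ \<equiv> 17::nat"
abbreviation (input) "rPick \<equiv> 18::nat"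
abbreviation (input) "rPow \<equiv> 19::nat"
abbreviation (input) "rRound \<equiv> 20::nat"
abbreviation (input) "rOK \<equiv> 21::nat"
abbreviation (input) "rBudget \<equiv> 22::nat"
abbreviation (input) "rCount \<equiv> 23::nat"

abbreviation (input) seq (infixr ";;" 60) where "c1 ;; c2 \<equiv> Seq c1 c2"
abbreviation (input) "reads_pos a \<equiv> Less (Num 0) a"
abbreviation (input) "reads_zero a \<equiv> Less a (Num 1)"
abbreviation (input) "incr r \<equiv> Assign r (Plus (Reg r) (Num 1))"
abbreviation (input) "double r \<equiv> Assign r (Plus (Reg r) (Reg r))"
abbreviation (input) "next_row r \<equiv> Assign r (Plus (Reg r) (Reg rWidth))"
abbreviation (input) "chosen_cell j \<equiv> Plus (Reg rBase) (Reg j)"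
abbreviation (input) "element_bit p \<equiv> Mem (Plus (Reg p) (Reg rK))"
abbreviation (input) "level_bit \<equiv> Mem (Plus (Plus (Reg rRow) (Reg rM)) (Reg rI))"

text \<open>There is no multiplication, so row addresses are carried along: they start at 3, behind
  the three sizes, and grow by the row width. The primed registers keep this loop apart from the one
  of \<open>pick_best\<close> around it, which uses \<open>rJ\<close> and
  \<open>rRow\<close>.\<close>

definition test_covered :: com where
  "test_covered =
     Assign rCov (Num 0) ;; Assign rRow' (Num 3) ;;
     For rJ' rN
       (Cond (And (reads_pos (Mem (chosen_cell rJ'))) (reads_pos (element_bit rRow')))
          (Assign rCov (Num 1)) Skip ;;
        next_row rRow')"

definition compute_gain :: com where
  "compute_gain =
     Assign rGain (Num 0) ;;
     For rK rM
       (test_covered ;;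
        Cond (And (reads_pos (element_bit rRow)) (reads_zero (Reg rCov))) (incr rGain) Skip)"

text \<open>
  When no pick gains anything, \<^term>\<open>rBest\<close> keeps the value \<open>card U\<close> and the final store hits a
  cell beyond the indicator vector.
\<close>

definition pick_best :: com where
  "pick_best =
     Assign rBest (Reg rN) ;; Assign rBestGain (Num 0) ;; Assign rRow (Num 3) ;;
     For rJ rN
       (compute_gain ;;
        Cond (And (reads_pos level_bit) (Less (Reg rBestGain) (Reg rGain)))
          (Assign rBest (Reg rJ) ;; Assign rBestGain (Reg rGain)) Skip ;;
        next_row rRow) ;;
     Store (chosen_cell rBest) (Num 1)"

text \<open>\<open>rPow\<close> starts at 2 because level 0 stands for \<open>S 1\<close>, which
  gets \<open>2 ^ 1\<close> picks.\<close>

definition greedy_round :: com where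
  "greedy_round = Assign rPow (Num 2) ;; For rI rT (For rPick rPow pick_best ;; double rPow)"

definition choose_free :: com where
  "choose_free =
     Assign rRow (Num 3) ;;
     For rJ rN
       (Assign rCount (Num 0) ;;
        For rI rT (Cond (reads_pos level_bit) (Assign rCount (Num 1)) Skip) ;;
        Cond (reads_zero (Reg rCount)) (Store (chosen_cell rJ) (Num 1)) Skip ;;
        next_row rRow)"

text \<open>The budget factor is the number of rounds. Twice this number is the bound for
  \<open>S 1\<close>, and doubling gives the bound for the next level.\<close>

definition check_solution :: com where
  "check_solution =
     Assign rOK (Num 1) ;;
     For rK rM (test_covered ;; Cond (reads_zero (Reg rCov)) (Assign rOK (Num 0)) Skip) ;;
     Assign rBudget (Plus (Reg rRounds) (Reg rRounds)) ;;
     For rI rT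
       (Assign rCount (Num 0) ;; Assign rRow (Num 3) ;;
        For rJ rN
          (Cond (And (reads_pos (Mem (chosen_cell rJ))) (reads_pos level_bit)) (incr rCount) Skip ;;
           next_row rRow) ;;
        Cond (Less (Reg rBudget) (Reg rCount)) (Assign rOK (Num 0)) Skip ;;
        double rBudget)"

text \<open>Binary increment of the indicator vector, with the carry in \<^term>\<open>rCount\<close>.\<close>

definition next_subset :: com where
  "next_subset =
     Assign rCount (Num 1) ;;
     For rJ rN
       (Cond (reads_pos (Reg rCount))
          (Cond (reads_pos (Mem (chosen_cell rJ)))
             (Store (chosen_cell rJ) (Num 0))
             (Store (chosen_cell rJ) (Num 1) ;; Assign rCount (Num 0)))
          Skip)"

definition copy_output :: com where
  "copy_output = For rJ rN (Store (Reg rJ) (Mem (chosen_cell rJ)))"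

text \<open>\<open>d\<close> is fixed with the program, so the product with the number of levels
  unrolls into \<open>d\<close> additions.\<close>

primrec times_levels :: "nat \<Rightarrow> aexp" where
  "times_levels 0 = Num 0"
| "times_levels (Suc d) = Plus (Reg rT) (times_levels d)"

text \<open>
  The indicator vector is built in the cells from \<^term>\<open>rBase\<close> on, beyond the input and beyond
  the output cells, which overlap with the input.
\<close>

definition load_input :: "nat \<Rightarrow> com" where
  "load_input d =
     Assign rN (Mem (Num 0)) ;; Assign rM (Mem (Num 1)) ;; Assign rT (Mem (Num 2)) ;;
     Assign rWidth (Plus (Reg rM) (Reg rT)) ;; Assign rRounds (Plus (times_levels d) (Num 1)) ;;
     Assign rBase (Plus (Reg rN) (Num 3)) ;;
     For rJ rN (Assign rBase (Plus (Reg rBase) (Reg rWidth)))"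

definition set_cover_program :: "nat \<Rightarrow> com" where
  "set_cover_program d =
     load_input d ;; choose_free ;; For rRound rRounds greedy_round ;; check_solution ;;
     While (reads_zero (Reg rOK)) (next_subset ;; check_solution) ;; copy_output"

section \<open>Registers and memory touched by the components\<close>

lemma writes_test_covered [simp]: "writes test_covered = {rCov, rRow', rJ'}"
  and writes_compute_gain [simp]: "writes compute_gain = {rGain, rK, rCov, rRow', rJ'}"
  and writes_pick_best [simp]:
    "writes pick_best = {rBest, rBestGain, rRow, rJ, rGain, rK, rCov, rRow', rJ'}"
  and writes_greedy_round [simp]:
    "writes greedy_round =
       {rPow, rI, rPick, rBest, rBestGain, rRow, rJ, rGain, rK, rCov, rRow', rJ'}"
  and writes_check_solution [simp]:
    "writes check_solution = {rOK, rK, rCov, rRow', rJ', rBudget, rI, rCount, rRow, rJ}"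
  and writes_next_subset [simp]: "writes next_subset = {rCount, rJ}"
  by (auto simp: test_covered_def compute_gain_def pick_best_def greedy_round_def
    check_solution_def next_subset_def)

lemma storeless_test_covered [simp]: "storeless test_covered"
  and storeless_compute_gain [simp]: "storeless compute_gain"
  and storeless_check_solution [simp]: "storeless check_solution"
  by (auto simp: test_covered_def compute_gain_def check_solution_def)

section \<open>Binary codes of index sets\<close>

lemma set_encode_Suc:
  "set_encode (X \<inter> {..<Suc q}) = set_encode (X \<inter> {..<q}) + (if q \<in> X then 2 ^ q else 0)"
proof -
  have "X \<inter> {..<Suc q} = (if q \<in> X then insert q (X \<inter> {..<q}) else X \<inter> {..<q})"
    by (auto simp: less_Suc_eq)
  then show ?thesis by simp
qed

lemma set_encode_less:
  assumes "X \<subseteq> {..<n}"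
  shows "set_encode X < 2 ^ n"
proof -
  have "set_encode (X \<inter> {..<q}) < 2 ^ q" for q
    by (induction q) (auto simp: set_encode_Suc)
  moreover have "X \<inter> {..<n} = X"
    using assms by auto
  ultimately show ?thesis by metis
qed

text \<open>\<open>L\<close> will be the length of the input and \<open>R\<close> the number of
  rounds. The time bounds defined below depend on these two only and do not aim at tight constants.
  \<open>2 ^ T \<le> 2 * L\<close> keeps the number of picks per level polynomial.\<close>

locale machine_instance = cover_instance +
  fixes R L :: nat
  assumes size_bounds: "n \<le> L" "m \<le> L" "T \<le> L" "2 ^ T \<le> 2 * L"
begin

definition base :: nat where
  "base = n + 3 + n * (m + T)"

definition regs_ok :: "state \<Rightarrow> bool" where
  "regs_ok s \<longleftrightarrow> fst s rN = n \<and> fst s rM = m \<and> fst s rT = T \<and> fst s rWidth = m + T \<and>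
     fst s rBase = base \<and> fst s rRounds = R"

definition input_ok :: "(nat \<Rightarrow> nat) \<Rightarrow> bool" where
  "input_ok \<mu> \<longleftrightarrow>
     (\<forall>j<n. \<forall>k<m. \<mu> (3 + j * (m + T) + k) = of_bool (C j k)) \<and>
     (\<forall>j<n. \<forall>i<T. \<mu> (3 + j * (m + T) + m + i) = of_bool (V j i))"

definition chosen :: "(nat \<Rightarrow> nat) \<Rightarrow> nat set" where
  "chosen \<mu> = {j. j < n \<and> \<mu> (base + j) \<noteq> 0}"

definition ready :: "state \<Rightarrow> bool" where
  "ready s \<longleftrightarrow> regs_ok s \<and> input_ok (snd s)"

lemma ready_regs:
  assumes "ready s"
  shows "fst s rN = n" "fst s rM = m" "fst s rT = T" "fst s rWidth = m + T"
    "fst s rBase = base" "fst s rRounds = R"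
  using assms by (auto simp: ready_def regs_ok_def)

lemma ready_bits:
  assumes "ready s" "j < n"
  shows "k < m \<Longrightarrow> snd s (3 + j * (m + T) + k) = of_bool (C j k)"
    and "i < T \<Longrightarrow> snd s (3 + j * (m + T) + m + i) = of_bool (V j i)"
  using assms by (auto simp: ready_def input_ok_def)

lemma chosen_iff: "j < n \<Longrightarrow> 0 < \<mu> (base + j) \<longleftrightarrow> j \<in> chosen \<mu>"
  by (auto simp: chosen_def)

lemma chosen_subset: "chosen \<mu> \<subseteq> {..<n}"
  by (auto simp: chosen_def)

lemma finite_chosen [simp]: "finite (chosen \<mu>)"
  by (simp add: chosen_def)

lemma ready_frame:
  assumes "frame c s s'" "storeless c" "\<forall>r\<in>writes c. rRounds < r" "ready s"
  shows "ready s'" "snd s' = snd s"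
proof -
  have "r \<notin> writes c" if "r \<le> rRounds" for r
    using assms(3) that by force
  then show "ready s'" "snd s' = snd s"
    using assms by (auto simp: frame_def ready_def regs_ok_def)
qed

lemma ready_set_reg: "rRounds < r \<Longrightarrow> ready s \<Longrightarrow> ready (set_reg r v s)"
  by (auto simp: ready_def regs_ok_def set_reg_def)

lemma fst_set_reg [simp]: "fst (set_reg r v s) = (fst s)(r := v)"
  and snd_set_reg [simp]: "snd (set_reg r v s) = snd s"
  and fst_set_mem [simp]: "fst (set_mem a v s) = fst s"
  and snd_set_mem [simp]: "snd (set_mem a v s) = (snd s)(a := v)"
  by (auto simp: set_reg_def set_mem_def)

text \<open>Input bits lie below \<open>base\<close>: a position inside row \<open>j\<close>
  precedes the end of that row, and all \<open>n\<close> rows together take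
  \<open>n * (m + T)\<close> cells.\<close>

lemma input_ok_upd:
  assumes "input_ok \<mu>" "base \<le> a"
  shows "input_ok (\<mu>(a := v))"
proof -
  have lt: "3 + j * (m + T) + q < base" if "j < n" "q < m + T" for j q
  proof -
    have "j * (m + T) + q < (j + 1) * (m + T)"
      using that by simp
    also have "\<dots> \<le> n * (m + T)"
      using that by (intro mult_right_mono) auto
    finally show ?thesis by (simp add: base_def)
  qed
  have "3 + j * (m + T) + k \<noteq> a" if "j < n" "k < m" for j k
    using lt[of j k] that assms(2) by simp
  moreover have "3 + j * (m + T) + m + i \<noteq> a" if "j < n" "i < T" for j i
    using lt[of j "m + i"] that assms(2) by simp
  ultimately show ?thesis
    using assms(1) unfolding input_ok_def by simp
qed

lemma ready_set_mem: "ready s \<Longrightarrow> base \<le> a \<Longrightarrow> ready (set_mem a v s)"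
  by (auto simp: ready_def regs_ok_def input_ok_upd)

lemma chosen_upd:
  "chosen (\<mu>(base + j := v)) =
     (if j < n then if v = 0 then chosen \<mu> - {j} else insert j (chosen \<mu>) else chosen \<mu>)"
  by (auto simp: chosen_def)

section \<open>Components with their running times\<close>

definition covered_time :: nat where
  "covered_time = 4 + loop_time L 6"

lemma wp_test_covered:
  assumes s: "ready s" "fst s rK = k" "k < m"
  shows "wp test_covered
    (\<lambda>t s'. t \<le> covered_time \<and> fst s' rCov = of_bool (k \<notin> uncovered (chosen (snd s)))) s"
proof -
  let ?Inv = "\<lambda>i s'. fst s' rRow' = 3 + i * (m + T) \<and>
    fst s' rCov = of_bool (\<exists>j<i. j \<in> chosen (snd s) \<and> C j k)"
  let ?body = "Cond (And (reads_pos (Mem (chosen_cell rJ'))) (reads_pos (element_bit rRow')))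
    (Assign rCov (Num 1)) Skip ;; next_row rRow'"
  let ?s0 = "set_reg rRow' 3 (set_reg rCov 0 s)"
  have s0: "ready ?s0"
    using s by (simp add: ready_set_reg)
  have "wp (For rJ' rN ?body) (\<lambda>t s'. t \<le> loop_time L 6 \<and> ?Inv n s') ?s0"
  proof (rule wp_For[where Inv = ?Inv])
    fix i s'
    assume i: "i < n" "?Inv i s'" "fst s' rJ' = i" and fr: "frame (For rJ' rN ?body) ?s0 s'"
    have s': "ready s'" "snd s' = snd s"
      using ready_frame[OF fr] s0 by auto
    have "fst s' rK = k"
      using fr s by (simp add: frame_def)
    then show "wp ?body (\<lambda>t s''. t \<le> 6 \<and> ?Inv (Suc i) s'') s'"
      using i s s' ready_bits[OF s'(1) i(1)]
      by (auto simp: wp_Seq ready_regs[OF s'(1)] chosen_iff less_Suc_eq)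
  qed (use s size_bounds in \<open>auto simp: ready_regs\<close>)
  then show ?thesis
    unfolding test_covered_def wp_Seq wp_Assign aval.simps
    by (rule wp_mono) (use s in \<open>auto simp: covered_time_def uncovered_def chosen_def\<close>)
qed

definition gain_time :: nat where
  "gain_time = 2 + loop_time L (covered_time + 4)"

lemma wp_compute_gain:
  assumes s: "ready s" "fst s rRow = 3 + j * (m + T)" "j < n"
  shows "wp compute_gain
    (\<lambda>t s'. t \<le> gain_time \<and> fst s' rGain = gain (chosen (snd s)) j) s"
proof -
  let ?Inv = "\<lambda>i s'. fst s' rGain = card {k \<in> uncovered (chosen (snd s)). C j k \<and> k < i}"
  let ?body = "test_covered ;;
        Cond (And (reads_pos (element_bit rRow)) (reads_zero (Reg rCov))) (incr rGain) Skip"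
  let ?s0 = "set_reg rGain 0 s"
  have s0: "ready ?s0"
    using s by (simp add: ready_set_reg)
  have "wp (For rK rM ?body) (\<lambda>t s'. t \<le> loop_time L (covered_time + 4) \<and> ?Inv m s') ?s0"
  proof (rule wp_For[where Inv = ?Inv])
    fix i s'
    assume i: "i < m" "?Inv i s'" "fst s' rK = i" and fr: "frame (For rK rM ?body) ?s0 s'"
    have s': "ready s'" "snd s' = snd s"
      using ready_frame[OF fr] s0 by auto
    have row: "fst s' rRow = 3 + j * (m + T)"
      using fr s by (simp add: frame_def)
    show "wp ?body (\<lambda>t s''. t \<le> covered_time + 4 \<and> ?Inv (Suc i) s'') s'"
    proof (rule wp_SeqI[OF wp_test_covered[OF s'(1) i(3,1)]], elim conjE)
      fix t1 s1
      assume t1: "t1 \<le> covered_time"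
        and cov: "fst s1 rCov = of_bool (i \<notin> uncovered (chosen (snd s')))"
        and fr1: "frame test_covered s' s1"
      have s1: "ready s1" "snd s1 = snd s"
        using ready_frame[OF fr1] s' by auto
      have regs: "fst s1 rK = i" "fst s1 rRow = 3 + j * (m + T)" "fst s1 rGain = fst s' rGain"
        using fr1 i row by (auto simp: frame_def)
      have "{k \<in> uncovered (chosen (snd s)). C j k \<and> k < Suc i} =
          (if i \<in> uncovered (chosen (snd s)) \<and> C j i then insert i else id)
            {k \<in> uncovered (chosen (snd s)). C j k \<and> k < i}"
        by (auto simp: less_Suc_eq)
      then show "wp (Cond (And (reads_pos (element_bit rRow)) (reads_zero (Reg rCov))) (incr rGain) Skip)
          (\<lambda>t2 s''. t1 + Suc t2 \<le> covered_time + 4 \<and> ?Inv (Suc i) s'') s1"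
        using t1 cov s' s1 regs i ready_bits(1)[OF s1(1) s(3) i(1)] by auto
    qed
  qed (use s size_bounds in \<open>auto simp: ready_regs\<close>)
  moreover have "{k \<in> uncovered (chosen (snd s)). C j k \<and> k < m} =
      {k \<in> uncovered (chosen (snd s)). C j k}"
    by (auto simp: uncovered_def)
  ultimately show ?thesis
    unfolding compute_gain_def wp_Seq wp_Assign aval.simps
    by (elim wp_mono) (simp add: gain_time_def gain_def)
qed

definition pick_time :: nat where
  "pick_time = 8 + loop_time L (gain_time + 8)"

lemma wp_pick_best:
  assumes s: "ready s" "fst s rI = i" "i < T"
  shows "wp pick_best (\<lambda>t s'. t \<le> pick_time \<and> ready s' \<and>
    greedy_step i (chosen (snd s)) (chosen (snd s'))) s"
proof -
  define X where "X = chosen (snd s)"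
  \<comment> \<open>The comparison in the program is strict, so the default \<open>n\<close> in
    \<open>rBest\<close> survives as long as all gains seen in level \<open>i\<close> are 0;
    otherwise \<open>rBest\<close> attains the largest of them.\<close>
  let ?Inv = "\<lambda>q s'. fst s' rRow = 3 + q * (m + T) \<and>
    (\<forall>j<q. V j i \<longrightarrow> gain X j \<le> fst s' rBestGain) \<and>
    (fst s' rBest = n \<and> fst s' rBestGain = 0 \<or>
     fst s' rBest \<in> level i \<and> fst s' rBestGain = gain X (fst s' rBest))"
  let ?upd = "Cond (And (reads_pos level_bit) (Less (Reg rBestGain) (Reg rGain)))
          (Assign rBest (Reg rJ) ;; Assign rBestGain (Reg rGain)) Skip ;;
        next_row rRow"
  let ?body = "compute_gain ;; ?upd"
  let ?s0 = "set_reg rRow 3 (set_reg rBestGain 0 (set_reg rBest (fst s rN) s))"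
  have s0: "ready ?s0"
    using s by (simp add: ready_set_reg)
  have loop: "wp (For rJ rN ?body) (\<lambda>t s'. t \<le> loop_time L (gain_time + 8) \<and> ?Inv n s') ?s0"
  proof (rule wp_For[where Inv = ?Inv])
    fix q s'
    assume q: "q < n" "?Inv q s'" "fst s' rJ = q" and fr: "frame (For rJ rN ?body) ?s0 s'"
    have s': "ready s'" "snd s' = snd s"
      using ready_frame[OF fr] s0 by auto
    have I: "fst s' rI = i"
      using fr s by (simp add: frame_def)
    show "wp ?body (\<lambda>t s''. t \<le> gain_time + 8 \<and> ?Inv (Suc q) s'') s'"
    proof (rule wp_SeqI[OF wp_compute_gain[OF s'(1) _ q(1)]], use q in simp, elim conjE)
      fix t1 s1
      assume t1: "t1 \<le> gain_time" and g: "fst s1 rGain = gain (chosen (snd s')) q"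
        and fr1: "frame compute_gain s' s1"
      have s1: "ready s1" "snd s1 = snd s"
        using ready_frame[OF fr1] s' by auto
      have regs: "fst s1 rI = i" "fst s1 rJ = q" "fst s1 rRow = fst s' rRow"
        "fst s1 rBest = fst s' rBest" "fst s1 rBestGain = fst s' rBestGain"
        using fr1 q I by (auto simp: frame_def)
      have g': "fst s1 rGain = gain X q"
        using g s' by (simp add: X_def)
      show "wp ?upd (\<lambda>t2 s''. t1 + Suc t2 \<le> gain_time + 8 \<and> ?Inv (Suc q) s'') s1"
        using t1 g' regs q s(3) ready_bits(2)[OF s1(1) q(1) s(3)]
        by (auto simp: wp_Seq ready_regs[OF s1(1)] less_Suc_eq level_def
            intro: less_imp_le order_trans)
    qed
  qed (use s size_bounds in \<open>auto simp: ready_regs\<close>)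
  show ?thesis
    unfolding pick_best_def wp_Seq wp_Assign aval.simps
  proof (rule wp_mono[OF loop], elim conjE)
    fix t s'
    assume t: "t \<le> loop_time L (gain_time + 8)" and fr: "frame (For rJ rN ?body) ?s0 s'"
      and best: "\<forall>j<n. V j i \<longrightarrow> gain X j \<le> fst s' rBestGain"
        "fst s' rBest = n \<and> fst s' rBestGain = 0 \<or>
         fst s' rBest \<in> level i \<and> fst s' rBestGain = gain X (fst s' rBest)"
    have s': "ready s'" "snd s' = snd s"
      using ready_frame[OF fr] s0 by auto
    let ?s = "set_mem (base + fst s' rBest) 1 s'"
    have "ready ?s"
      using s' by (simp add: ready_set_mem)
    moreover have "greedy_step i X (chosen (snd ?s))"
      using best(2)
    proof
      assume b: "fst s' rBest = n \<and> fst s' rBestGain = 0"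
      \<comment> \<open>The store hits cell \<open>base + n\<close>, just beyond the vector. All
        gains in level \<open>i\<close> are 0 here, so keeping \<open>X\<close> satisfies
        \<open>greedy_step\<close>.\<close>
      then have "chosen (snd ?s) = X"
        by (simp add: chosen_upd X_def s')
      then show ?thesis
        using b best(1) by (auto simp: greedy_step_def level_def)
    next
      assume b: "fst s' rBest \<in> level i \<and> fst s' rBestGain = gain X (fst s' rBest)"
      then have "chosen (snd ?s) = insert (fst s' rBest) X"
        by (simp add: chosen_upd X_def s' level_def)
      \<comment> \<open>Adding the best set lowers the count by its gain, which dominates the gain
        of each candidate.\<close>
      moreover have "card (uncovered (insert (fst s' rBest) X)) + gain X j \<le> card (uncovered X)"
        if "j \<in> level i" for j
        using gain_insert[of "fst s' rBest" X] b best(1) that by (fastforce simp: level_def)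
      ultimately show ?thesis
        using b by (auto simp: greedy_step_def)
    qed
    ultimately show "wp (Store (chosen_cell rBest) (Num 1))
        (\<lambda>t2 s'. 1 + Suc (1 + Suc (1 + Suc (t + Suc t2))) \<le> pick_time \<and> ready s' \<and>
          greedy_step i (chosen (snd s)) (chosen (snd s'))) s'"
      using t by (simp add: pick_time_def X_def ready_regs[OF s'(1)])
  qed
qed

definition round_time :: nat where
  "round_time = 2 + loop_time L (loop_time (2 * L) pick_time + 2)"

lemma wp_greedy_round:
  assumes s: "ready s"
  shows "wp greedy_round (\<lambda>t s'. t \<le> round_time \<and> ready s' \<and>
    greedy_levels T (chosen (snd s)) (chosen (snd s'))) s"
proof -
  define X where "X = chosen (snd s)"
  let ?Inv = "\<lambda>i s'. ready s' \<and> fst s' rPow = 2 ^ Suc i \<and> greedy_levels i X (chosen (snd s'))"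
  let ?body = "For rPick rPow pick_best ;; double rPow"
  let ?s0 = "set_reg rPow 2 s"
  have s0: "ready ?s0"
    using s by (simp add: ready_set_reg)
  have "wp (For rI rT ?body)
      (\<lambda>t s'. t \<le> loop_time L (loop_time (2 * L) pick_time + 2) \<and> ?Inv T s') ?s0"
  proof (rule wp_For[where Inv = ?Inv])
    fix i s'
    assume i: "i < T" "?Inv i s'" "fst s' rI = i"
    \<comment> \<open>\<open>Suc i \<le> T\<close> bounds the number of picks by
      \<open>2 ^ T\<close>, hence by \<open>2 * L\<close>: this makes a round polynomial although
      its picks double from level to level.\<close>
    have "(2::nat) ^ Suc i \<le> 2 ^ T"
      using i(1) by (intro power_increasing) auto
    then have pow: "2 ^ Suc i \<le> 2 * L"
      using size_bounds(4) by linarith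
    let ?Inv' = "\<lambda>q s''. ready s'' \<and> (greedy_step i ^^ q) (chosen (snd s')) (chosen (snd s''))"
    have "wp (For rPick rPow pick_best)
        (\<lambda>t s''. t \<le> loop_time (2 * L) pick_time \<and> ?Inv' (2 ^ Suc i) s'') s'"
    proof (rule wp_For[where Inv = ?Inv'])
      fix q s''
      assume q: "?Inv' q s''" and fr: "frame (For rPick rPow pick_best) s' s''"
      have "fst s'' rI = i"
        using fr i by (simp add: frame_def)
      then show "wp pick_best (\<lambda>t s''. t \<le> pick_time \<and> ?Inv' (Suc q) s'') s''"
        using q i by (intro wp_mono[OF wp_pick_best]) auto
    qed (use i pow in \<open>auto simp: ready_set_reg\<close>)
    then show "wp ?body (\<lambda>t s''. t \<le> loop_time (2 * L) pick_time + 2 \<and> ?Inv (Suc i) s'') s'"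
    proof (rule wp_SeqI, elim conjE)
      fix t1 s1
      assume t1: "t1 \<le> loop_time (2 * L) pick_time" and s1: "ready s1"
        "(greedy_step i ^^ (2 ^ Suc i)) (chosen (snd s')) (chosen (snd s1))"
        and fr: "frame (For rPick rPow pick_best) s' s1"
      have "fst s1 rPow = 2 ^ Suc i"
        using fr i by (simp add: frame_def)
      moreover have "greedy_levels (Suc i) X (chosen (snd s1))"
        using i(2) s1(2) by (auto simp del: power_Suc)
      ultimately show "wp (double rPow)
          (\<lambda>t2 s''. t1 + Suc t2 \<le> loop_time (2 * L) pick_time + 2 \<and> ?Inv (Suc i) s'') s1"
        using t1 s1(1) by (simp add: ready_set_reg del: greedy_levels.simps)
    qed
  qed (use s size_bounds in \<open>auto simp: ready_regs ready_set_reg X_def\<close>)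
  then show ?thesis
    unfolding greedy_round_def wp_Seq wp_Assign aval.simps
    by (rule wp_mono) (auto simp: round_time_def X_def)
qed

lemma wp_greedy_rounds:
  assumes s: "ready s"
  shows "wp (For rRound rRounds greedy_round) (\<lambda>t s'. t \<le> loop_time R round_time \<and> ready s' \<and>
    (greedy_levels T ^^ R) (chosen (snd s)) (chosen (snd s'))) s"
proof -
  let ?Inv = "\<lambda>q s'. ready s' \<and> (greedy_levels T ^^ q) (chosen (snd s)) (chosen (snd s'))"
  show ?thesis
  proof (rule wp_For[where Inv = ?Inv])
    fix q s'
    assume "?Inv q s'"
    then show "wp greedy_round (\<lambda>t s''. t \<le> round_time \<and> ?Inv (Suc q) s'') s'"
      by (intro wp_mono[OF wp_greedy_round]) auto
  qed (use s in \<open>auto simp: ready_set_reg ready_regs\<close>)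
qed

definition free_time :: nat where
  "free_time = 2 + loop_time L (loop_time L 2 + 8)"

lemma wp_choose_free:
  assumes s: "ready s" "chosen (snd s) = {}"
  shows "wp choose_free (\<lambda>t s'. t \<le> free_time \<and> ready s' \<and> chosen (snd s') = free) s"
proof -
  let ?Inv = "\<lambda>q s'. ready s' \<and> fst s' rRow = 3 + q * (m + T) \<and>
    chosen (snd s') = free \<inter> {..<q}"
  let ?loop = "For rI rT (Cond (reads_pos level_bit) (Assign rCount (Num 1)) Skip)"
  let ?upd = "Cond (reads_zero (Reg rCount)) (Store (chosen_cell rJ) (Num 1)) Skip ;;
        next_row rRow"
  let ?body = "Assign rCount (Num 0) ;; ?loop ;; ?upd"
  let ?s0 = "set_reg rRow 3 s"
  have "wp (For rJ rN ?body) (\<lambda>t s'. t \<le> loop_time L (loop_time L 2 + 8) \<and> ?Inv n s') ?s0"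
  proof (rule wp_For[where Inv = ?Inv])
    fix q s'
    assume q: "q < n" "?Inv q s'" "fst s' rJ = q"
    let ?s1 = "set_reg rCount 0 s'"
    let ?Inv' = "\<lambda>i s''. fst s'' rCount = of_bool (\<exists>i'<i. V q i')"
    have s1: "ready ?s1"
      using q by (simp add: ready_set_reg)
    have "wp ?loop (\<lambda>t s''. t \<le> loop_time L 2 \<and> ?Inv' T s'') ?s1"
    proof (rule wp_For[where Inv = ?Inv'])
      fix i s''
      assume i: "i < T" "?Inv' i s''" "fst s'' rI = i" and fr: "frame ?loop ?s1 s''"
      have s'': "ready s''"
        using ready_frame[OF fr] s1 by simp
      have "fst s'' rRow = 3 + q * (m + T)"
        using fr q by (simp add: frame_def)
      then show "wp (Cond (reads_pos level_bit) (Assign rCount (Num 1)) Skip)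
          (\<lambda>t s''. t \<le> 2 \<and> ?Inv' (Suc i) s'') s''"
        using i ready_bits(2)[OF s'' q(1) i(1)]
        by (auto simp: ready_regs[OF s''] less_Suc_eq)
    qed (use q size_bounds in \<open>auto simp: ready_regs\<close>)
    then show "wp ?body (\<lambda>t s''. t \<le> loop_time L 2 + 8 \<and> ?Inv (Suc q) s'') s'"
      unfolding wp_Seq[of "Assign rCount (Num 0)"] wp_Assign aval.simps
    proof (rule wp_SeqI, elim conjE)
      fix t1 s2
      assume t1: "t1 \<le> loop_time L 2" and cnt: "?Inv' T s2" and fr: "frame ?loop ?s1 s2"
      have s2: "ready s2" "snd s2 = snd s'"
        using ready_frame[OF fr] s1 by auto
      have regs: "fst s2 rRow = 3 + q * (m + T)" "fst s2 rJ = q"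
        using fr q by (auto simp: frame_def)
      have "free \<inter> {..<Suc q} = (if \<exists>i<T. V q i then free \<inter> {..<q} else insert q (free \<inter> {..<q}))"
        using q(1) by (auto simp: free_def less_Suc_eq)
      then show "wp ?upd (\<lambda>t2 s''. 1 + Suc (t1 + Suc t2) \<le> loop_time L 2 + 8 \<and> ?Inv (Suc q) s'') s2"
        using t1 cnt q s2 regs
        by (auto simp: wp_Seq ready_regs[OF s2(1)] ready_set_reg ready_set_mem chosen_upd)
    qed
  qed (use s size_bounds in \<open>auto simp: ready_regs ready_set_reg\<close>)
  then show ?thesis
    unfolding choose_free_def wp_Seq[of "Assign rRow (Num 3)"] wp_Assign aval.simps
    by (rule wp_mono) (auto simp: free_time_def free_def)
qed

definition check_time :: nat where
  "check_time = 6 + loop_time L (covered_time + 3) + loop_time L (loop_time L 5 + 12)"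

lemma wp_check_solution:
  assumes s: "ready s"
  shows "wp check_solution (\<lambda>t s'. t \<le> check_time \<and>
    fst s' rOK = of_bool (solution R (chosen (snd s)))) s"
proof -
  define X where "X = chosen (snd s)"
  let ?body1 = "test_covered ;; Cond (reads_zero (Reg rCov)) (Assign rOK (Num 0)) Skip"
  let ?Inv1 = "\<lambda>k s'. fst s' rOK = of_bool (\<forall>k'<k. k' \<notin> uncovered X)"
  let ?s0 = "set_reg rOK 1 s"
  have s0: "ready ?s0"
    using s by (simp add: ready_set_reg)
  have loop1: "wp (For rK rM ?body1)
      (\<lambda>t s'. t \<le> loop_time L (covered_time + 3) \<and> ?Inv1 m s') ?s0"
  proof (rule wp_For[where Inv = ?Inv1])
    fix k s'
    assume k: "k < m" "?Inv1 k s'" "fst s' rK = k" and fr: "frame (For rK rM ?body1) ?s0 s'"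
    have s': "ready s'" "snd s' = snd s"
      using ready_frame[OF fr] s0 by auto
    show "wp ?body1 (\<lambda>t s''. t \<le> covered_time + 3 \<and> ?Inv1 (Suc k) s'') s'"
    proof (rule wp_SeqI[OF wp_test_covered[OF s'(1) k(3,1)]], elim conjE)
      fix t1 s1
      assume t1: "t1 \<le> covered_time"
        and cov: "fst s1 rCov = of_bool (k \<notin> uncovered (chosen (snd s')))"
        and fr1: "frame test_covered s' s1"
      have "fst s1 rOK = fst s' rOK"
        using fr1 by (simp add: frame_def)
      then show "wp (Cond (reads_zero (Reg rCov)) (Assign rOK (Num 0)) Skip)
          (\<lambda>t2 s''. t1 + Suc t2 \<le> covered_time + 3 \<and> ?Inv1 (Suc k) s'') s1"
        using t1 cov s' k by (auto simp: X_def less_Suc_eq)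
    qed
  qed (use s size_bounds in \<open>auto simp: ready_regs\<close>)
  \<comment> \<open>Coverage is already recorded in \<open>rOK\<close>, and this pass can only reset
    it. Before level \<open>i\<close> is treated, \<open>rBudget\<close> holds exactly the bound for
    this level.\<close>
  let ?Inv2 = "\<lambda>i s'. fst s' rBudget = R * 2 ^ Suc i \<and>
    fst s' rOK = of_bool (uncovered X = {} \<and> (\<forall>i'<i. card (X \<inter> level i') \<le> R * 2 ^ Suc i'))"
  let ?body3 = "Cond (And (reads_pos (Mem (chosen_cell rJ))) (reads_pos level_bit)) (incr rCount) Skip ;;
           next_row rRow"
  let ?upd = "Cond (Less (Reg rBudget) (Reg rCount)) (Assign rOK (Num 0)) Skip ;;
        double rBudget"
  let ?body2 = "Assign rCount (Num 0) ;; Assign rRow (Num 3) ;; For rJ rN ?body3 ;; ?upd"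
  have loop2: "wp (For rI rT ?body2)
      (\<lambda>t s'. t \<le> loop_time L (loop_time L 5 + 12) \<and> ?Inv2 T s') s1"
    if s1: "ready s1" "snd s1 = snd s" "?Inv2 0 s1" for s1
  proof (rule wp_For[where Inv = ?Inv2])
    fix i s'
    assume i: "i < T" "?Inv2 i s'" "fst s' rI = i" and fr: "frame (For rI rT ?body2) s1 s'"
    have s': "ready s'" "snd s' = snd s"
      using ready_frame[OF fr] s1 by auto
    let ?s2 = "set_reg rRow 3 (set_reg rCount 0 s')"
    have s2: "ready ?s2"
      using s' by (simp add: ready_set_reg)
    let ?Inv3 = "\<lambda>q s''. fst s'' rRow = 3 + q * (m + T) \<and>
      fst s'' rCount = card (X \<inter> level i \<inter> {..<q})"
    have "wp (For rJ rN ?body3) (\<lambda>t s''. t \<le> loop_time L 5 \<and> ?Inv3 n s'') ?s2"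
    proof (rule wp_For[where Inv = ?Inv3])
      fix q s''
      assume q: "q < n" "?Inv3 q s''" "fst s'' rJ = q" and fr: "frame (For rJ rN ?body3) ?s2 s''"
      have s'': "ready s''" "snd s'' = snd s"
        using ready_frame[OF fr] s2 s' by auto
      have I: "fst s'' rI = i"
        using fr i by (simp add: frame_def)
      have "X \<inter> level i \<inter> {..<Suc q} =
          (if q \<in> X \<and> V q i then insert q (X \<inter> level i \<inter> {..<q}) else X \<inter> level i \<inter> {..<q})"
        using q(1) by (auto simp: level_def less_Suc_eq)
      then show "wp ?body3 (\<lambda>t s''. t \<le> 5 \<and> ?Inv3 (Suc q) s'') s''"
        using q I i(1) s'' ready_bits(2)[OF s''(1) q(1) i(1)]
        by (auto simp: wp_Seq ready_regs[OF s''(1)] chosen_iff X_def)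
    qed (use s' size_bounds in \<open>auto simp: ready_regs\<close>)
    then show "wp ?body2 (\<lambda>t s''. t \<le> loop_time L 5 + 12 \<and> ?Inv2 (Suc i) s'') s'"
      unfolding wp_Seq[of "Assign r a" for r a] wp_Assign aval.simps
    proof (rule wp_SeqI, elim conjE)
      fix t1 s3
      assume t1: "t1 \<le> loop_time L 5" and cnt: "fst s3 rCount = card (X \<inter> level i \<inter> {..<n})"
        and fr: "frame (For rJ rN ?body3) ?s2 s3"
      have regs: "fst s3 rBudget = fst s' rBudget" "fst s3 rOK = fst s' rOK"
        using fr by (auto simp: frame_def)
      have "X \<inter> level i \<inter> {..<n} = X \<inter> level i"
        by (auto simp: level_def)
      then show "wp ?upd (\<lambda>t2 s''. 1 + Suc (1 + Suc (t1 + Suc t2)) \<le> loop_time L 5 + 12 \<and>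
          ?Inv2 (Suc i) s'') s3"
        using t1 cnt regs i(2) by (auto simp: wp_Seq less_Suc_eq)
    qed
  qed (use s1 size_bounds in \<open>auto simp: ready_regs\<close>)
  show ?thesis
    unfolding check_solution_def wp_Seq[of "Assign r a" for r a] wp_Assign aval.simps
  proof (rule wp_SeqI[OF loop1], elim conjE)
    fix t1 s1
    assume t1: "t1 \<le> loop_time L (covered_time + 3)" and ok: "?Inv1 m s1"
      and fr: "frame (For rK rM ?body1) ?s0 s1"
    have s1: "ready s1" "snd s1 = snd s"
      using ready_frame[OF fr] s0 by auto
    let ?s1 = "set_reg rBudget (R + R) s1"
    have "(\<forall>k'<m. k' \<notin> uncovered X) \<longleftrightarrow> uncovered X = {}"
      by (auto simp: uncovered_def)
    then have "wp (For rI rT ?body2)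
      (\<lambda>t s'. t \<le> loop_time L (loop_time L 5 + 12) \<and> ?Inv2 T s') ?s1"
      using s1 ok by (intro loop2) (auto simp: ready_set_reg)
    then have "wp (For rI rT ?body2) (\<lambda>t2 s'. 1 + Suc (t1 + Suc (1 + Suc t2)) \<le> check_time \<and>
        fst s' rOK = of_bool (solution R (chosen (snd s)))) ?s1"
      by (rule wp_mono)
        (use t1 chosen_subset in \<open>auto simp: check_time_def solution_def in_budget_def X_def\<close>)
    then show "wp (Assign rBudget (Plus (Reg rRounds) (Reg rRounds)) ;; For rI rT ?body2)
        (\<lambda>t2 s'. 1 + Suc (t1 + Suc t2) \<le> check_time \<and>
          fst s' rOK = of_bool (solution R (chosen (snd s)))) s1"
      unfolding wp_Seq[of "Assign r a" for r a] wp_Assign aval.simps ready_regs[OF s1(1)] .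
  qed
qed

section \<open>Exhaustive search in binary order\<close>

lemma wp_next_subset:
  assumes s: "ready s"
  shows "wp next_subset (\<lambda>t s'. ready s' \<and>
    (set_encode (chosen (snd s')) = Suc (set_encode (chosen (snd s))) \<or>
     set_encode (chosen (snd s')) = 0 \<and> Suc (set_encode (chosen (snd s))) = 2 ^ n)) s"
proof -
  define X where "X = chosen (snd s)"
  \<comment> \<open>The lowest \<open>q\<close> bits together with the carry represent the old value
    of these bits plus one; the higher bits are untouched.\<close>
  let ?Inv = "\<lambda>q s'. ready s' \<and> fst s' rCount \<le> 1 \<and>
    set_encode (chosen (snd s') \<inter> {..<q}) + fst s' rCount * 2 ^ q = Suc (set_encode (X \<inter> {..<q})) \<and>
    (\<forall>j\<ge>q. j \<in> chosen (snd s') \<longleftrightarrow> j \<in> X)"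
  let ?body = "Cond (reads_pos (Reg rCount))
          (Cond (reads_pos (Mem (chosen_cell rJ)))
             (Store (chosen_cell rJ) (Num 0))
             (Store (chosen_cell rJ) (Num 1) ;; Assign rCount (Num 0)))
          Skip"
  let ?s0 = "set_reg rCount 1 s"
  have "wp (For rJ rN ?body) (\<lambda>t s'. t \<le> loop_time n 10 \<and> ?Inv n s') ?s0"
  proof (rule wp_For[where Inv = ?Inv])
    fix q s'
    assume q: "q < n" "?Inv q s'" "fst s' rJ = q"
    have s': "ready s'"
      using q by simp
    have del: "(Y - {q}) \<inter> {..<q} = Y \<inter> {..<q}" "insert q Y \<inter> {..<q} = Y \<inter> {..<q}" for Y
      by auto
    have "fst s' rCount = 0 \<or> fst s' rCount = 1"
      using q by linarith
    then show "wp ?body (\<lambda>t s''. t \<le> 10 \<and> ?Inv (Suc q) s'') s'"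
      using q by (auto simp: wp_Seq ready_regs[OF s'] chosen_iff ready_set_reg ready_set_mem
          chosen_upd set_encode_Suc del)
  qed (use s in \<open>auto simp: ready_regs ready_set_reg X_def\<close>)
  moreover have "chosen \<mu> \<inter> {..<n} = chosen \<mu>" for \<mu>
    using chosen_subset by blast
  ultimately show ?thesis
    unfolding next_subset_def wp_Seq[of "Assign r a" for r a] wp_Assign aval.simps
  proof (elim wp_mono)
    fix t s'
    assume *: "t \<le> loop_time n 10 \<and> ?Inv n s'" and **: "\<And>\<mu>. chosen \<mu> \<inter> {..<n} = chosen \<mu>"
    \<comment> \<open>Since the old code is below \<open>2 ^ n\<close>, a carry left after
      \<open>n\<close> bits means a wrap-around from the largest code to 0.\<close>
    have "set_encode X < 2 ^ n"
      unfolding X_def by (rule set_encode_less[OF chosen_subset])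
    moreover have "fst s' rCount = 0 \<or> fst s' rCount = 1"
      using * by linarith
    ultimately show "ready s' \<and>
        (set_encode (chosen (snd s')) = Suc (set_encode (chosen (snd s))) \<or>
         set_encode (chosen (snd s')) = 0 \<and> Suc (set_encode (chosen (snd s))) = 2 ^ n)"
      using * ** by (auto simp: X_def)
  qed
qed

text \<open>
  The subsets are visited in the cyclic order of their binary codes, so the distance to the code of
  \<open>Opt\<close> decreases until some solution is met.
\<close>

lemma wp_search:
  assumes Opt: "solution R Opt"
    and s: "ready s" "fst s rOK = of_bool (solution R (chosen (snd s)))"
  shows "wp (While (reads_zero (Reg rOK)) (next_subset ;; check_solution))
    (\<lambda>t s'. ready s' \<and> solution R (chosen (snd s')) \<and> (solution R (chosen (snd s)) \<longrightarrow> t = 1)) s"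
proof -
  \<comment> \<open>The difference of the codes modulo \<open>2 ^ n\<close>; the case split keeps
    the subtraction on natural numbers from truncating.\<close>
  let ?dist = "\<lambda>X. if set_encode X \<le> set_encode Opt then set_encode Opt - set_encode X
    else 2 ^ n + set_encode Opt - set_encode X"
  show ?thesis
    using s
  proof (induction "?dist (chosen (snd s))" arbitrary: s rule: less_induct)
    case less
    show ?case
    proof (cases "solution R (chosen (snd s))")
      case True
      \<comment> \<open>Entered at a solution, the loop costs just its failing test. No other time
        bound is claimed for the search.\<close>
      then show ?thesis
        using less.prems by (subst wp_While) simp
    next
      case False
      have "finite Opt" "set_encode Opt < 2 ^ n"
        using Opt finite_subset[of Opt] set_encode_less by (auto simp: solution_def)
      \<comment> \<open>\<open>set_encode\<close> is injective on finite sets, and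
        \<open>Opt\<close> is a solution while the current set is not, so their codes differ and the
        distance is positive.\<close>
      then have ne: "set_encode (chosen (snd s)) \<noteq> set_encode Opt" "set_encode Opt < 2 ^ n"
        using False Opt set_encode_eq[of "chosen (snd s)" Opt] by auto
      have "wp (next_subset ;; check_solution)
          (\<lambda>t1. wp (While (reads_zero (Reg rOK)) (next_subset ;; check_solution))
            (\<lambda>t2 s'. ready s' \<and> solution R (chosen (snd s')))) s"
      proof (rule wp_SeqI[OF wp_next_subset[OF less.prems(1)]], elim conjE)
        fix t1 s1
        assume s1: "ready s1" "set_encode (chosen (snd s1)) = Suc (set_encode (chosen (snd s))) \<or>
          set_encode (chosen (snd s1)) = 0 \<and> Suc (set_encode (chosen (snd s))) = 2 ^ n"
        show "wp check_solution (\<lambda>t2. wp (While (reads_zero (Reg rOK)) (next_subset ;; check_solution))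
            (\<lambda>t2 s'. ready s' \<and> solution R (chosen (snd s')))) s1"
        proof (rule wp_mono[OF wp_check_solution[OF s1(1)]], elim conjE)
          fix t2 s2
          assume ok: "fst s2 rOK = of_bool (solution R (chosen (snd s1)))"
            and fr: "frame check_solution s1 s2"
          have s2: "ready s2" "snd s2 = snd s1"
            using ready_frame[OF fr] s1 by auto
          have "set_encode (chosen (snd s)) < 2 ^ n"
            by (rule set_encode_less[OF chosen_subset])
          then have "?dist (chosen (snd s2)) < ?dist (chosen (snd s))"
            using s1(2) ne by (auto simp: s2)
          from less.hyps[OF this] show "wp (While (reads_zero (Reg rOK)) (next_subset ;; check_solution))
            (\<lambda>t2 s'. ready s' \<and> solution R (chosen (snd s'))) s2"
            using s2 ok by (auto elim: wp_mono)
        qed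
      qed
      then show ?thesis
        using False less.prems by (subst wp_While) simp
    qed
  qed
qed

section \<open>Copying, loading and the whole program\<close>

definition copy_time :: nat where
  "copy_time = loop_time L 1"

lemma wp_copy_output:
  assumes s: "ready s"
  shows "wp copy_output (\<lambda>t s'. t \<le> copy_time \<and> {j. j < n \<and> snd s' j \<noteq> 0} = chosen (snd s)) s"
proof -
  \<comment> \<open>The copy may overwrite input, but cells from \<open>n\<close> on stay intact,
    and the source cells start at \<open>base\<close>, which is at least \<open>n\<close>.\<close>
  let ?Inv = "\<lambda>q s'. (\<forall>j<q. snd s' j = snd s (base + j)) \<and> (\<forall>a\<ge>n. snd s' a = snd s a)"
  let ?body = "Store (Reg rJ) (Mem (chosen_cell rJ))"
  have "wp (For rJ rN ?body) (\<lambda>t s'. t \<le> loop_time L 1 \<and> ?Inv n s') s"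
  proof (rule wp_For[where Inv = ?Inv])
    fix q s'
    assume q: "q < n" "?Inv q s'" "fst s' rJ = q" and fr: "frame (For rJ rN ?body) s s'"
    have "fst s' rBase = base"
      using fr s by (simp add: frame_def ready_regs)
    moreover have "n \<le> base + q"
      by (simp add: base_def)
    ultimately show "wp ?body (\<lambda>t s''. t \<le> 1 \<and> ?Inv (Suc q) s'') s'"
      using q by (auto simp: less_Suc_eq)
  qed (use s size_bounds in \<open>auto simp: ready_regs\<close>)
  then show ?thesis
    unfolding copy_output_def by (rule wp_mono) (auto simp: copy_time_def chosen_def)
qed

lemma aval_times_levels: "aval (times_levels d) s = d * fst s rT"
  by (induction d) auto

definition load_time :: nat where
  "load_time = 12 + loop_time L 1"

lemma wp_load_input:
  assumes s: "snd s 0 = n" "snd s 1 = m" "snd s 2 = T" "input_ok (snd s)" and R: "R = d * T + 1"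
  shows "wp (load_input d) (\<lambda>t s'. t \<le> load_time \<and> ready s' \<and> snd s' = snd s) s"
proof -
  \<comment> \<open>The product \<open>n * (m + T)\<close> is accumulated by repeated
    addition.\<close>
  let ?Inv = "\<lambda>q s'. fst s' rBase = n + 3 + q * (m + T)"
  let ?body = "Assign rBase (Plus (Reg rBase) (Reg rWidth))"
  define s0 where "s0 = set_reg rBase (n + 3) (set_reg rRounds R (set_reg rWidth (m + T)
    (set_reg rT T (set_reg rM m (set_reg rN n s)))))"
  have "wp (For rJ rN ?body) (\<lambda>t s'. t \<le> loop_time L 1 \<and> ?Inv n s') s0"
  proof (rule wp_For[where Inv = ?Inv])
    fix q s'
    assume q: "?Inv q s'" and fr: "frame (For rJ rN ?body) s0 s'"
    have "fst s' rWidth = m + T"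
      using fr by (simp add: frame_def s0_def)
    then show "wp ?body (\<lambda>t s''. t \<le> 1 \<and> ?Inv (Suc q) s'') s'"
      using q by simp
  qed (use size_bounds in \<open>auto simp: s0_def\<close>)
  then have "wp (For rJ rN ?body)
      (\<lambda>t s'. 1 + Suc (1 + Suc (1 + Suc (1 + Suc (1 + Suc (1 + Suc t))))) \<le> load_time \<and>
        ready s' \<and> snd s' = snd s) s0"
    by (rule wp_mono)
      (use s in \<open>auto simp: load_time_def frame_def s0_def ready_def regs_ok_def base_def\<close>)
  \<comment> \<open>The same state, with the number of rounds in the form in which the program
    evaluates it.\<close>
  moreover have "s0 = set_reg rBase (n + 3) (set_reg rRounds (aval (Plus (times_levels d) (Num 1))
    (set_reg rWidth (m + T) (set_reg rT T (set_reg rM m (set_reg rN n s))))) (set_reg rWidth (m + T)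
    (set_reg rT T (set_reg rM m (set_reg rN n s)))))"
    using R by (simp add: s0_def aval_times_levels)
  ultimately show ?thesis
    using s by (simp add: load_input_def wp_Seq)
qed

text \<open>The final 6 counts five sequencing steps and the single step of a search that starts at
  a solution.\<close>

definition program_time :: nat where
  "program_time = load_time + free_time + loop_time R round_time + check_time + copy_time + 6"

lemma wp_set_cover_program:
  assumes s: "snd s 0 = n" "snd s 1 = m" "snd s 2 = T" "input_ok (snd s)" "chosen (snd s) = {}"
    and R: "R = d * T + 1" and Opt: "solution 1 Opt"
  shows "wp (set_cover_program d)
    (\<lambda>t s'. solution R {j. j < n \<and> snd s' j \<noteq> 0} \<and> (m < 2 ^ R \<longrightarrow> t \<le> program_time)) s"
  unfolding set_cover_program_def
proof (rule wp_SeqI[OF wp_load_input[OF s(1-4) R]], elim conjE)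
  fix t1 s1
  assume t1: "t1 \<le> load_time" and s1: "ready s1" "snd s1 = snd s"
  \<comment> \<open>\<open>R\<close> is at least 1, owing to the \<open>+ 1\<close>, so
    \<open>Opt\<close> also meets the budgets with factor \<open>R\<close> and the search has a
    target.\<close>
  have OptR: "solution R Opt"
    using Opt R by (auto intro: solution_mono)
  let ?search = "While (reads_zero (Reg rOK)) (next_subset ;; check_solution)"
  let ?Q = "\<lambda>t s'. solution R {j. j < n \<and> snd s' j \<noteq> 0} \<and> (m < 2 ^ R \<longrightarrow> t \<le> program_time)"
  have "chosen (snd s1) = {}"
    using s s1 by simp
  then show "wp (choose_free ;; For rRound rRounds greedy_round ;; check_solution ;; ?search ;; copy_output)
      (\<lambda>t2. ?Q (t1 + Suc t2)) s1"
  proof (rule wp_SeqI[OF wp_choose_free[OF s1(1)]], elim conjE)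
    fix t2 s2
    assume t2: "t2 \<le> free_time" and s2: "ready s2" "chosen (snd s2) = free"
    show "wp (For rRound rRounds greedy_round ;; check_solution ;; ?search ;; copy_output)
        (\<lambda>t3. ?Q (t1 + Suc (t2 + Suc t3))) s2"
    proof (rule wp_SeqI[OF wp_greedy_rounds[OF s2(1)]], elim conjE)
      fix t3 s3
      assume t3: "t3 \<le> loop_time R round_time"
        and s3: "ready s3" "(greedy_levels T ^^ R) (chosen (snd s2)) (chosen (snd s3))"
      \<comment> \<open>For such \<open>m\<close> the search stops at its first test.\<close>
      have greedy: "solution R (chosen (snd s3))" if "m < 2 ^ R"
        using greedy_solution[OF _ Opt that] s2 s3 by simp
      show "wp (check_solution ;; ?search ;; copy_output)
          (\<lambda>t4. ?Q (t1 + Suc (t2 + Suc (t3 + Suc t4)))) s3"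
      proof (rule wp_SeqI[OF wp_check_solution[OF s3(1)]], elim conjE)
        fix t4 s4
        assume t4: "t4 \<le> check_time" and ok: "fst s4 rOK = of_bool (solution R (chosen (snd s3)))"
          and fr: "frame check_solution s3 s4"
        have s4: "ready s4" "snd s4 = snd s3"
          using ready_frame[OF fr] s3 by auto
        show "wp (?search ;; copy_output)
            (\<lambda>t5. ?Q (t1 + Suc (t2 + Suc (t3 + Suc (t4 + Suc t5))))) s4"
        proof (rule wp_SeqI[OF wp_search[OF OptR s4(1)]], use ok s4 in simp, elim conjE)
          fix t5 :: nat and s5
          assume s5: "ready s5" "solution R (chosen (snd s5))"
            and t5: "solution R (chosen (snd s4)) \<longrightarrow> t5 = 1"
          show "wp copy_output
              (\<lambda>t6. ?Q (t1 + Suc (t2 + Suc (t3 + Suc (t4 + Suc (t5 + Suc t6)))))) s5"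
            by (rule wp_mono[OF wp_copy_output[OF s5(1)]])
              (use t1 t2 t3 t4 t5 s4 s5 greedy in \<open>auto simp: program_time_def\<close>)
        qed
      qed
    qed
  qed
qed

end

section \<open>From set systems to the program\<close>

lemma nth_concat_map:
  assumes "\<And>j. j < n \<Longrightarrow> length (f j) = w" "j < n" "q < w"
  shows "concat (map f [0..<n]) ! (j * w + q) = f j ! q"
  using assms
proof (induction n)
  case (Suc n)
  have "sum_list (map (\<lambda>j. length (f j)) [0..<n]) = sum_list (map (\<lambda>_. w) [0..<n])"
    using Suc.prems(1) by (intro arg_cong[where f = sum_list] map_cong) auto
  then have len: "length (concat (map f [0..<n])) = n * w"
    by (simp add: length_concat o_def sum_list_triv)
  show ?case
  proof (cases "j < n")
    case True
    have "j * w + q < (j + 1) * w"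
      using Suc.prems by simp
    also have "\<dots> \<le> n * w"
      using True by (intro mult_right_mono) auto
    finally show ?thesis
      using Suc True len by (simp add: nth_append)
  next
    case False
    then have "j = n"
      using Suc.prems by simp
    then show ?thesis
      using len by (simp add: nth_append)
  qed
qed simp

section \<open>Layout of the encoded instance\<close>

lemma length_encode: "length (encode A U S e u) = 3 + card U * (card A + levels U)"
  by (simp add: encode_def length_concat o_def sum_list_triv)

lemma nth_encode_sizes:
  "encode A U S e u ! 0 = card U" "encode A U S e u ! 1 = card A"
  "encode A U S e u ! 2 = levels U"
  by (simp_all add: encode_def)

lemma nth_encode_bits:
  assumes "j < card U"
  shows "k < card A \<Longrightarrow>
      encode A U S e u ! (3 + j * (card A + levels U) + k) = of_bool (e k \<in> u j)"
    and "i < levels U \<Longrightarrow>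
      encode A U S e u ! (3 + j * (card A + levels U) + card A + i) = of_bool (u j \<in> S (Suc i))"
proof -
  let ?row = "\<lambda>j. map (\<lambda>k. of_bool (e k \<in> u j)) [0..<card A] @
    map (\<lambda>i. of_bool (u j \<in> S i)) [1..<levels U + 1] :: nat list"
  have row: "encode A U S e u ! (3 + j * (card A + levels U) + q) = ?row j ! q"
    if "q < card A + levels U" for q
  proof -
    have "encode A U S e u ! (3 + j * (card A + levels U) + q) =
        concat (map ?row [0..<card U]) ! (j * (card A + levels U) + q)"
      by (simp add: encode_def)
    also have "\<dots> = ?row j ! q"
      using assms that by (intro nth_concat_map) auto
    finally show ?thesis .
  qed
  show "k < card A \<Longrightarrow>
      encode A U S e u ! (3 + j * (card A + levels U) + k) = of_bool (e k \<in> u j)"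
  proof -
    assume k: "k < card A"
    then have "encode A U S e u ! (3 + j * (card A + levels U) + k) = ?row j ! k"
      by (intro row) simp
    also have "\<dots> = of_bool (e k \<in> u j)"
      using k by (simp add: nth_append del: upt_Suc)
    finally show ?thesis .
  qed
  show "i < levels U \<Longrightarrow>
      encode A U S e u ! (3 + j * (card A + levels U) + card A + i) = of_bool (u j \<in> S (Suc i))"
  proof -
    assume i: "i < levels U"
    have "3 + j * (card A + levels U) + card A + i = 3 + j * (card A + levels U) + (card A + i)"
      by (rule add.assoc)
    then have "encode A U S e u ! (3 + j * (card A + levels U) + card A + i) = ?row j ! (card A + i)"
      using row[of "card A + i"] i by (simp only: add_less_cancel_left)
    \<comment> \<open>The listing of the families starts at 1, so position \<open>i\<close> of the
      level bits belongs to \<open>S (Suc i)\<close>.\<close>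
    also have "\<dots> = of_bool (u j \<in> S (Suc i))"
      using i by (simp add: nth_append del: upt_Suc)
    finally show ?thesis .
  qed
qed

section \<open>Size of the number of levels\<close>

lemma card_le_two_power_levels: "card U \<le> 2 ^ levels U"
proof (cases "card U = 0")
  case False
  have "log 2 (real (card U)) \<le> real (levels U)"
    unfolding levels_def by (rule real_nat_ceiling_ge)
  then have "real (card U) \<le> 2 powr real (levels U)"
    using False by (simp add: log_le_iff)
  then have "real (card U) \<le> real (2 ^ levels U)"
    by (simp add: powr_realpow)
  then show ?thesis
    by (simp only: of_nat_le_iff)
qed simp

text \<open>Rounding the logarithm up adds less than 1 and so costs at most a factor 2. For
  \<open>card U = 0\<close> there are no levels, and the bound would read
  \<open>1 \<le> 0\<close>.\<close>

lemma two_power_levels_le: "card U \<noteq> 0 \<Longrightarrow> 2 ^ levels U \<le> 2 * card U"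
proof -
  assume U: "card U \<noteq> 0"
  then have "0 \<le> log 2 (real (card U))"
    by simp
  then have "real (levels U) \<le> log 2 (real (card U)) + 1"
    unfolding levels_def by linarith
  also have "\<dots> = log 2 (2 * real (card U))"
    using U by (simp add: log_mult)
  finally have "2 powr real (levels U) \<le> 2 * real (card U)"
    using U by (simp add: le_log_iff)
  then have "real (2 ^ levels U) \<le> real (2 * card U)"
    by (simp add: powr_realpow)
  then show ?thesis
    by (simp only: of_nat_le_iff)
qed

section \<open>Polynomial time bounds\<close>

definition is_poly :: "(nat \<Rightarrow> nat) \<Rightarrow> bool" where
  "is_poly f \<longleftrightarrow> (\<exists>p. \<forall>x. f x = poly p x)"

lemma is_poly_const: "is_poly (\<lambda>_. a)"
  unfolding is_poly_def by (rule exI[of _ "[:a:]"]) simp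

lemma is_poly_id: "is_poly (\<lambda>x. x)"
  unfolding is_poly_def by (rule exI[of _ "[:0, 1:]"]) simp

lemma is_poly_add: "is_poly f \<Longrightarrow> is_poly g \<Longrightarrow> is_poly (\<lambda>x. f x + g x)"
  unfolding is_poly_def by (metis poly_add)

lemma is_poly_mult: "is_poly f \<Longrightarrow> is_poly g \<Longrightarrow> is_poly (\<lambda>x. f x * g x)"
  unfolding is_poly_def by (metis poly_mult)

text \<open>With this closure property the bound for nested loops is recognised as polynomial from
  its shape, without computing coefficients.\<close>

lemma is_poly_loop_time: "is_poly f \<Longrightarrow> is_poly g \<Longrightarrow> is_poly (\<lambda>x. loop_time (f x) (g x))"
  unfolding loop_time_def by (intro is_poly_add is_poly_mult is_poly_const)

lemma program_time_poly:
  "\<exists>p. \<forall>n m T V L. machine_instance n m T V L \<longrightarrow>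
     machine_instance.program_time (d * T + 1) L \<le> poly p L"
proof -
  \<comment> \<open>This is \<open>program_time\<close> with all its parts unfolded and
    \<open>T\<close> replaced by \<open>L\<close> in the number of rounds.\<close>
  have "is_poly (\<lambda>L. (12 + loop_time L 1) + (2 + loop_time L (loop_time L 2 + 8)) +
    loop_time (d * L + 1) (2 + loop_time L (loop_time (2 * L) (8 + loop_time L ((2 + loop_time L
    (4 + loop_time L 6 + 4)) + 8)) + 2)) +
    (6 + loop_time L (4 + loop_time L 6 + 3) + loop_time L (loop_time L 5 + 12)) +
    loop_time L 1 + 6)"
    by (intro is_poly_add is_poly_mult is_poly_loop_time is_poly_const is_poly_id)
  then obtain p where p: "\<And>L. (12 + loop_time L 1) + (2 + loop_time L (loop_time L 2 + 8)) +
    loop_time (d * L + 1) (2 + loop_time L (loop_time (2 * L) (8 + loop_time L ((2 + loop_time L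
    (4 + loop_time L 6 + 4)) + 8)) + 2)) +
    (6 + loop_time L (4 + loop_time L 6 + 3) + loop_time L (loop_time L 5 + 12)) +
    loop_time L 1 + 6 = poly p L"
    unfolding is_poly_def by blast
  have mono: "loop_time K B \<le> loop_time K' B" if "K \<le> K'" for K K' B
    using that by (simp add: loop_time_def)
  show ?thesis
  proof (intro exI allI impI)
    fix n m T V L
    assume "machine_instance n m T V L"
    \<comment> \<open>The interpretation has to name a relation for \<open>C\<close>; the time bound
      is the same for every choice.\<close>
    then interpret machine_instance n m T "\<lambda>_ _. False" V "d * T + 1" L .
    show "program_time \<le> poly p L"
      unfolding p[symmetric] program_time_def load_time_def free_time_def round_time_def
        pick_time_def gain_time_def covered_time_def check_time_def copy_time_def
      by (intro add_mono mono order_refl mult_left_mono size_bounds(3)) auto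
  qed
qed

text \<open>From 2 on the logarithm is at least 1, so rounding up at most doubles it and the
  \<open>+ 1\<close> is absorbed; hence the constant \<open>2 * d + 1\<close>.\<close>

lemma levels_bigo: "(\<lambda>n. real (d * nat \<lceil>log 2 (real n)\<rceil> + 1)) \<in> O(\<lambda>n. log 2 (real n))"
proof (rule bigoI)
  show "\<forall>\<^sub>F n in sequentially.
      norm (real (d * nat \<lceil>log 2 (real n)\<rceil> + 1)) \<le> (2 * real d + 1) * norm (log 2 (real n))"
    using eventually_ge_at_top[of 2]
  proof eventually_elim
    case (elim n)
    then have 1: "1 \<le> log 2 (real n)"
      by (simp add: le_log_iff)
    then have "real (nat \<lceil>log 2 (real n)\<rceil>) \<le> 2 * log 2 (real n)"
      by linarith
    then have "real d * real (nat \<lceil>log 2 (real n)\<rceil>) \<le> real d * (2 * log 2 (real n))"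
      by (intro mult_left_mono) auto
    then show ?case
      using 1 by (simp add: algebra_simps)
  qed
qed

section \<open>From sets to indices and back\<close>

locale encoded_instance =
  fixes A :: "'a set" and U :: "'a set set" and S :: "nat \<Rightarrow> 'a set set"
    and e :: "nat \<Rightarrow> 'a" and u :: "nat \<Rightarrow> 'a set"
  assumes inst: "logbgt_setcov A U S"
    and e: "bij_betw e {..<card A} A" and u: "bij_betw u {..<card U} U"
begin

sublocale cover_instance "card U" "card A" "levels U" "\<lambda>j k. e k \<in> u j" "\<lambda>j i. u j \<in> S (Suc i)"
proof
  fix j i i'
  assume i: "i < levels U" "i' < levels U" "u j \<in> S (Suc i)" "u j \<in> S (Suc i')"
  have "disjoint_family_on S {1..levels U}"
    using inst by (simp add: logbgt_setcov_def)
  then have "S (Suc i) \<inter> S (Suc i') = {}" if "i \<noteq> i'"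
    using i that by (auto simp: disjoint_family_on_def)
  then show "i = i'"
    using i by blast
qed

lemma finite_U: "finite U"
  using inst finite_subset[of U "Pow A"] by (simp add: logbgt_setcov_def)

lemma uncovered_empty_iff:
  assumes "X \<subseteq> {..<card U}"
  shows "uncovered X = {} \<longleftrightarrow> \<Union> (u ` X) = A"
proof -
  have "u ` X \<subseteq> u ` {..<card U}"
    using assms by (rule image_mono)
  also have "\<dots> = U"
    using u by (simp add: bij_betw_def)
  also have "U \<subseteq> Pow A"
    using inst by (simp add: logbgt_setcov_def)
  finally have "u ` X \<subseteq> Pow A" .
  \<comment> \<open>The chosen sets stay inside \<open>A\<close>, so their union equals
    \<open>A\<close> as soon as it contains each enumerated element.\<close>
  then have "\<Union> (u ` X) = A \<longleftrightarrow> e ` {..<card A} \<subseteq> \<Union> (u ` X)"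
    using e by (auto simp: bij_betw_def)
  then show ?thesis
    by (auto simp: uncovered_def)
qed

lemma card_level:
  assumes "X \<subseteq> {..<card U}"
  shows "card (X \<inter> level i) = card (u ` X \<inter> S (Suc i))"
proof -
  have "u ` X \<inter> S (Suc i) = u ` (X \<inter> level i)"
    using assms by (auto simp: level_def)
  moreover have "inj_on u (X \<inter> level i)"
    using u assms by (auto simp: bij_betw_def intro: inj_on_subset)
  ultimately show ?thesis
    by (simp add: card_image)
qed

text \<open>Injectivity of \<open>u\<close> preserves the cardinalities in the budgets. The
  equivalence serves in both directions: for the assumed \<open>1\<close>-valid solution and for the
  output of the program.\<close>

lemma solution_iff_valid:
  assumes X: "X \<subseteq> {..<card U}"
  shows "solution c X \<longleftrightarrow> valid A U S (real c) (u ` X)"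
proof -
  have "u ` X \<subseteq> U"
    using X u by (auto simp: bij_betw_def)
  moreover have "in_budget c X \<longleftrightarrow>
      (\<forall>i\<in>{1..levels U}. real (card (u ` X \<inter> S i)) \<le> real c * 2 ^ i)"
  proof -
    have "{1..levels U} = Suc ` {..<levels U}"
      by (simp add: image_Suc_lessThan)
    moreover have "card (X \<inter> level i) \<le> c * 2 ^ Suc i \<longleftrightarrow>
        real (card (u ` X \<inter> S (Suc i))) \<le> real c * 2 ^ Suc i" for i
    proof -
      have "real c * 2 ^ Suc i = real (c * 2 ^ Suc i)"
        by simp
      then show ?thesis
        by (simp only: card_level[OF X] of_nat_le_iff)
    qed
    ultimately show ?thesis
      by (auto simp: in_budget_def simp del: power_Suc)
  qed
  ultimately show ?thesis
    using X by (auto simp: solution_def valid_def feasible_def uncovered_empty_iff)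
qed

lemma valid_imp_solution:
  assumes "valid A U S 1 D"
  obtains X where "solution 1 X"
proof -
  have "D \<subseteq> u ` {..<card U}"
    using assms u by (simp add: valid_def feasible_def bij_betw_def)
  then obtain X where "X \<subseteq> {..<card U}" "D = u ` X"
    by (meson subset_imageE)
  then show thesis
    using assms that solution_iff_valid[of X 1] by simp
qed

lemma decode_eq: "decode U u s = u ` {j. j < card U \<and> snd s j \<noteq> 0}"
  by (auto simp: decode_def)

text \<open>A feasible \<open>D\<close> matters when \<open>U\<close> is empty: the encoding then
  has length 3 whatever \<open>card A\<close> is, but feasibility forces \<open>A\<close> to be
  empty.\<close>

lemma size_bounds:
  assumes "valid A U S c D"
  defines "L \<equiv> length (encode A U S e u)"
  shows "card U \<le> L" "card A \<le> L" "levels U \<le> L" "2 ^ levels U \<le> 2 * L"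
proof -
  define w where "w = card U * (card A + levels U)"
  have L: "L = 3 + w"
    by (simp add: L_def length_encode w_def)
  have "card U \<le> L \<and> card A \<le> L \<and> levels U \<le> L \<and> 2 ^ levels U \<le> 2 * L"
  proof (cases "card U = 0")
    case True
    then have "U = {}"
      using finite_U by simp
    then have "A = {}"
      using assms(1) by (auto simp: valid_def feasible_def)
    \<comment> \<open>Here \<open>log 2 0 = 0\<close> by convention, so there are no levels.\<close>
    then show ?thesis
      using \<open>U = {}\<close> by (simp add: levels_def L log_def)
  next
    case False
    have "card U \<le> L"
    \<comment> \<open>Without levels there is at most one set; otherwise each row has at least one
      bit.\<close>
    proof (cases "levels U = 0")
      case True
      then show ?thesis
        using card_le_two_power_levels[of U] by (simp add: L)
    next
      case False
      then have "card U * 1 \<le> w"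
        unfolding w_def by (intro mult_left_mono) auto
      then show ?thesis
        by (simp add: L)
    qed
    moreover have "1 * (card A + levels U) \<le> w"
      unfolding w_def using False by (intro mult_right_mono) auto
    ultimately show ?thesis
      using two_power_levels_le[OF False] by (simp add: L)
  qed
  then show "card U \<le> L" "card A \<le> L" "levels U \<le> L" "2 ^ levels U \<le> 2 * L"
    by auto
qed

lemma exec_set_cover_program:
  assumes "valid A U S 1 D" and p: "\<forall>n m T V L. machine_instance n m T V L \<longrightarrow>
     machine_instance.program_time (d * T + 1) L \<le> poly p L"
  shows "\<exists>t s'. exec (set_cover_program d) (initial (encode A U S e u)) t s' \<and>
    valid A U S (real (d * levels U + 1)) (decode U u s') \<and>
    (card A \<le> card U ^ d \<longrightarrow> t \<le> poly p (length (encode A U S e u)))"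
proof -
  let ?x = "encode A U S e u"
  interpret machine_instance "card U" "card A" "levels U" "\<lambda>j k. e k \<in> u j"
    "\<lambda>j i. u j \<in> S (Suc i)" "d * levels U + 1" "length ?x"
    using size_bounds[OF assms(1)] by unfold_locales
  obtain Opt where Opt: "solution 1 Opt"
    using valid_imp_solution assms(1) by blast
  have mem: "snd (initial ?x) a = (if a < length ?x then ?x ! a else 0)" for a
    by (simp add: initial_def)
  have lt: "3 + j * (card A + levels U) + q < length ?x"
    if "j < card U" "q < card A + levels U" for j q
  proof -
    have "j * (card A + levels U) + q < (j + 1) * (card A + levels U)"
      using that by simp
    also have "\<dots> \<le> card U * (card A + levels U)"
      using that by (intro mult_right_mono) auto
    finally show ?thesis
      by (simp add: length_encode)
  qed
  have "input_ok (snd (initial ?x))"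
    unfolding input_ok_def
  proof (intro conjI allI impI)
    fix j k
    assume "j < card U" "k < card A"
    then show "snd (initial ?x) (3 + j * (card A + levels U) + k) = of_bool (e k \<in> u j)"
      using lt[of j k] nth_encode_bits(1)[of j U k A] by (simp add: mem)
  next
    fix j i
    assume "j < card U" "i < levels U"
    then show "snd (initial ?x) (3 + j * (card A + levels U) + card A + i) =
        of_bool (u j \<in> S (Suc i))"
      using lt[of j "card A + i"] nth_encode_bits(2)[of j U i A]
      by (simp add: mem add.assoc)
  qed
  \<comment> \<open>The cells of the indicator vector lie beyond the input, where memory is
    initially 0.\<close>
  moreover have "chosen (snd (initial ?x)) = {}"
    by (auto simp: chosen_def mem base_def length_encode)
  moreover have "snd (initial ?x) 0 = card U" "snd (initial ?x) 1 = card A"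
    "snd (initial ?x) 2 = levels U"
    using nth_encode_sizes[of A U S e u] by (auto simp: mem length_encode)
  ultimately obtain t s' where ts: "exec (set_cover_program d) (initial ?x) t s'"
    and sol: "solution (d * levels U + 1) {j. j < card U \<and> snd s' j \<noteq> 0}"
    and time: "card A < 2 ^ (d * levels U + 1) \<longrightarrow> t \<le> program_time"
    using wp_set_cover_program[OF _ _ _ _ _ refl Opt] unfolding wp_def by blast
  have "valid A U S (real (d * levels U + 1)) (decode U u s')"
    using sol unfolding decode_eq by (subst (asm) solution_iff_valid) auto
  \<comment> \<open>\<open>card U\<close> is at most \<open>2 ^ levels U\<close>, and the extra
    round makes the inequality strict, so the time bound applies.\<close>
  moreover have "card A < 2 ^ (d * levels U + 1)" if "card A \<le> card U ^ d"
  proof -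
    have "card U ^ d \<le> (2 ^ levels U) ^ d"
      by (intro power_mono card_le_two_power_levels) simp
    also have "\<dots> < 2 ^ (d * levels U + 1)"
      by (simp add: power_mult[symmetric] mult.commute)
    finally show ?thesis
      using that by simp
  qed
  ultimately show ?thesis
    using ts time p machine_instance_axioms by (meson le_trans)
qed

end

theorem theoremF1:
  fixes d :: nat
  shows "\<exists>(P :: com) (c :: nat \<Rightarrow> real) (p :: nat poly).
    c \<in> O(\<lambda>n. log 2 (real n)) \<and>
    (\<forall>(A :: 'a set) U S e u.
       logbgt_setcov A U S \<longrightarrow>
       (\<exists>D. valid A U S 1 D) \<longrightarrow>
       bij_betw e {..<card A} A \<longrightarrow>
       bij_betw u {..<card U} U \<longrightarrow>
       (\<exists>t. halts_within P (encode A U S e u) t \<and>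
            (card A \<le> card U ^ d \<longrightarrow> t \<le> poly p (length (encode A U S e u))) \<and>
            measure_pmf.prob (run P (encode A U S e u) t)
              {cfg. valid A U S (c (card U)) (decode U u (snd cfg))} > 1 / 2))"
proof -
  obtain p where p: "\<forall>n m T V L. machine_instance n m T V L \<longrightarrow>
     machine_instance.program_time (d * T + 1) L \<le> poly p L"
    using program_time_poly by blast
  show ?thesis
  \<comment> \<open>The factor is the number of rounds, written as a function of
    \<open>card U\<close>; the search respects the same factor when the greedy phase fails.\<close>
  proof (rule exI[of _ "set_cover_program d"],
      rule exI[of _ "\<lambda>n. real (d * nat \<lceil>log 2 (real n)\<rceil> + 1)"],
      rule exI[of _ p], intro conjI allI impI)
    show "(\<lambda>n. real (d * nat \<lceil>log 2 (real n)\<rceil> + 1)) \<in> O(\<lambda>n. log 2 (real n))"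
      by (rule levels_bigo)
  next
    fix A :: "'a set" and U S e u
    assume "logbgt_setcov A U S" "\<exists>D. valid A U S 1 D"
      "bij_betw e {..<card A} A" "bij_betw u {..<card U} U"
    then obtain D where "encoded_instance A U S e u" "valid A U S 1 D"
      by (auto intro: encoded_instance.intro)
    from encoded_instance.exec_set_cover_program[OF this p]
    obtain t s' where ts: "exec (set_cover_program d) (initial (encode A U S e u)) t s'"
      and v: "valid A U S (real (d * levels U + 1)) (decode U u s')"
      and time: "card A \<le> card U ^ d \<longrightarrow> t \<le> poly p (length (encode A U S e u))"
      by blast
    \<comment> \<open>No coin is flipped, so the final distribution is a point mass and success has
      probability 1.\<close>
    have run: "run (set_cover_program d) (encode A U S e u) t = return_pmf (Skip, s')"
      unfolding run_def by (rule exec_steps[OF ts])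
    show "\<exists>t. halts_within (set_cover_program d) (encode A U S e u) t \<and>
        (card A \<le> card U ^ d \<longrightarrow> t \<le> poly p (length (encode A U S e u))) \<and>
        measure_pmf.prob (run (set_cover_program d) (encode A U S e u) t)
          {cfg. valid A U S (real (d * nat \<lceil>log 2 (real (card U))\<rceil> + 1))
             (decode U u (snd cfg))} > 1 / 2"
      using run v time by (intro exI[of _ t]) (auto simp: halts_within_def levels_def)
  qed
qed

end
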